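(* Let $X$ be a reflexive Banach space and $\varphi:X\to\mathbb{R}$ locally Lipschitz continuous satisfying the Cerami condition (C). Let $a\in\mathbb{R}$ and $a<b\le\infty$ be such that $K_a(\varphi)$ is finite and $K_c(\varphi)=\emptyset$ for all $c\in(a,b)$. Then there exists a continuous mapping $h:[0,1]\times(\overline\varphi^b\setminus K_b(\varphi))\to\overline\varphi^b\setminus K_b(\varphi)$ such that (i) $h(0,u)=u$ and $h(1,u)\in\overline\varphi^a$ for all $u\in\overline\varphi^b\setminus K_b(\varphi)$; (ii) $h(t,u)=u$ for all $(t,u)\in[0,1]\times\overline\varphi^a$; (iii) $\varphi(h(t,u))\le\varphi(u)$ for all $(t,u)\in[0,1]\times(\overline\varphi^b\setminus K_b(\varphi))$. In particular, $\overline\varphi^a$ is a strong deformation retract of $\overline\varphi^b\setminus K_b(\varphi)$.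
   Context: For locally Lipschitz $\varphi:X\to\mathbb{R}$: Clarke directional derivative $\varphi^\circ(u;v)=\limsup_{w\to u,\,t\to0^+}\frac{\varphi(w+tv)-\varphi(w)}{t}$; Clarke subdifferential $\partial\varphi(u)=\{u^*\in X^*:\langle u^*,v\rangle\le\varphi^\circ(u;v)\ \forall v\in X\}$ (nonempty, weakly* compact); $m(u)=\min_{u^*\in\partial\varphi(u)}\|u^*\|_*$. $u$ is a critical point if $m(u)=0$; $K(\varphi)$ is the set of critical points and $K_c(\varphi)=\{u\in K(\varphi):\varphi(u)=c\}$ (with $K_\infty(\varphi)=\emptyset$). $\varphi$ satisfies the Cerami condition (C) if every sequence $(u_n)$ with $(\varphi(u_n))$ bounded and $(1+\|u_n\|)m(u_n)\to0$ has a convergent subsequence. Sublevel sets: $\overline\varphi^c=\{u\in X:\varphi(u)\le c\}$, and $\overline\varphi^\infty=X$. *)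

theory Defs
  imports "HOL-Analysis.Analysis"
begin

definition reflexive_space :: "'a::real_normed_vector itself \<Rightarrow> bool" where
  "reflexive_space _ \<longleftrightarrow>
     (\<forall>F :: ('a \<Rightarrow>\<^sub>L real) \<Rightarrow>\<^sub>L real. \<exists>x::'a. \<forall>f. blinfun_apply F f = blinfun_apply f x)"

definition locally_lipschitz :: "('a::real_normed_vector \<Rightarrow> real) \<Rightarrow> bool" where
  "locally_lipschitz \<phi> \<longleftrightarrow>
     (\<forall>u. \<exists>e>0. \<exists>L. \<forall>x\<in>ball u e. \<forall>y\<in>ball u e. \<bar>\<phi> x - \<phi> y\<bar> \<le> L * dist x y)"

definition clarke_dd :: "('a::real_normed_vector \<Rightarrow> real) \<Rightarrow> 'a \<Rightarrow> 'a \<Rightarrow> real" where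
  "clarke_dd \<phi> u v = real_of_ereal
     (Limsup (at (u, 0) within (UNIV \<times> {0<..}))
        (\<lambda>(w, t). ereal ((\<phi> (w + t *\<^sub>R v) - \<phi> w) / t)))"

definition clarke_subdiff :: "('a::real_normed_vector \<Rightarrow> real) \<Rightarrow> 'a \<Rightarrow> ('a \<Rightarrow>\<^sub>L real) set" where
  "clarke_subdiff \<phi> u = {us. \<forall>v. blinfun_apply us v \<le> clarke_dd \<phi> u v}"

text \<open>m(u) = min of the dual norm over the Clarke subdifferential (the minimum is attained).\<close>
definition mnorm :: "('a::real_normed_vector \<Rightarrow> real) \<Rightarrow> 'a \<Rightarrow> real" where
  "mnorm \<phi> u = Inf (norm ` clarke_subdiff \<phi> u)"

definition crit :: "('a::real_normed_vector \<Rightarrow> real) \<Rightarrow> 'a set" where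
  "crit \<phi> = {u. mnorm \<phi> u = 0}"

definition crit_at :: "('a::real_normed_vector \<Rightarrow> real) \<Rightarrow> ereal \<Rightarrow> 'a set" where
  "crit_at \<phi> c = {u \<in> crit \<phi>. ereal (\<phi> u) = c}"

definition sublevel :: "('a \<Rightarrow> real) \<Rightarrow> ereal \<Rightarrow> 'a set" where
  "sublevel \<phi> c = {u. ereal (\<phi> u) \<le> c}"

definition cerami :: "('a::real_normed_vector \<Rightarrow> real) \<Rightarrow> bool" where
  "cerami \<phi> \<longleftrightarrow>
     (\<forall>u :: nat \<Rightarrow> 'a. bounded (range (\<lambda>n. \<phi> (u n))) \<and>
        (\<lambda>n. (1 + norm (u n)) * mnorm \<phi> (u n)) \<longlonglongrightarrow> 0
        \<longrightarrow> (\<exists>r. strict_mono r \<and> convergent (u \<circ> r)))"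

end

theory Submission
  imports Defs
begin

text \<open>
  Off the critical set, Hahn-Banach turns \<open>c < mnorm \<phi> u\<close> into a unit direction along which
  \<open>\<phi>\<close> decreases at rate more than \<open>c\<close> near \<open>u\<close>. A Stone-type partition of the noncritical
  region \<open>W = {a < \<phi> \<le> b} - crit \<phi>\<close> glues these directions to a continuous field, and no
  differential equation is needed: one Euler step \<open>u \<mapsto> u + \<tau> u *\<^sub>R V u\<close> with a
  continuous step size \<open>\<tau> > 0\<close> is a homotopy of \<open>W\<close>, and its iterates form polygons along
  which \<open>\<phi>\<close> drops by at least the length weighted with a continuous minorant of the Cerami
  weight. A polygon cannot converge inside \<open>W\<close>, because its limit would be fixed by the Euler
  step.

  Since \<open>K\<^sub>a\<close> is finite, every point \<open>z\<close> at level \<open>a\<close> is surrounded by annuli free of critical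
  points of level \<open>a\<close>; crossing one costs a fixed amount of \<open>\<phi>\<close>, so polygons that come close
  to \<open>z\<close> stay close to \<open>z\<close>. This stability yields both the convergence of each polygon to a
  point at level \<open>a\<close> and the continuity of the limit in the starting point.
\<close>

section \<open>The Clarke directional derivative\<close>

text \<open>A polygon stays strictly above level \<open>a\<close> for all time, only its limit
  reaches that level, and no speed of arrival uniform in the starting point is available. Hence the
  time interval \<open>[0, \<infinity>)\<close> is compressed to \<open>[0, 1)\<close>, and
  continuity at time 1 has to come from stability near the limit instead of from a rate. The factor
  \<open>1 + norm u\<close> in the Cerami condition is what lets a finite drop of \<phi> force
  boundedness: along a polygon, length divided by \<open>1 + norm\<close> dominates the growth of
  \<open>ln (1 + norm)\<close>. For finite \<open>b\<close> the set \<open>W\<close> contains the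
  noncritical points of level \<open>b\<close> and need not be open. The remedy is that no critical
  level lies strictly between \<open>a\<close> and \<open>b\<close>: a step from \<open>W\<close>
  that strictly lowers \<phi> can leave \<open>W\<close> only by reaching level \<open>a\<close>,
  and staying above \<open>a\<close> is an open condition.\<close>

lemma eventually_clarke_filter:
  fixes u :: "'a::real_normed_vector"
  shows "eventually P (at (u, 0::real) within (UNIV \<times> {0<..})) \<longleftrightarrow>
    (\<exists>r>0. \<forall>w\<in>ball u r. \<forall>t\<in>{0<..<r}. P (w, t))"
proof
  assume "eventually P (at (u, 0) within (UNIV \<times> {0<..}))"
  then obtain d where d: "d > 0"
    "\<And>x. x \<in> UNIV \<times> {0<..} \<Longrightarrow> x \<noteq> (u, 0) \<Longrightarrow> dist x (u, 0) < d \<Longrightarrow> P x"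
    unfolding eventually_at by blast
  have "P (w, t)" if "w \<in> ball u (d/2)" "t \<in> {0<..<d/2}" for w t
  proof (rule d(2))
    have "dist (w, t) (u, 0) \<le> dist w u + dist t 0"
      unfolding dist_Pair_Pair by (rule sqrt_sum_squares_le_sum) auto
    then show "dist (w, t) (u, 0) < d"
      using that by (auto simp: dist_commute)
  qed (use that in auto)
  then show "\<exists>r>0. \<forall>w\<in>ball u r. \<forall>t\<in>{0<..<r}. P (w, t)"
    using d(1) by (intro exI[of _ "d/2"]) auto
next
  assume "\<exists>r>0. \<forall>w\<in>ball u r. \<forall>t\<in>{0<..<r}. P (w, t)"
  then obtain r where r: "r > 0" "\<And>w t. w \<in> ball u r \<Longrightarrow> t \<in> {0<..<r} \<Longrightarrow> P (w, t)"
    by blast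
  show "eventually P (at (u, 0) within (UNIV \<times> {0<..}))"
    unfolding eventually_at
  proof (intro exI[of _ r] conjI ballI impI)
    fix x :: "'a \<times> real"
    assume x: "x \<in> UNIV \<times> {0<..}" "x \<noteq> (u, 0) \<and> dist x (u, 0) < r"
    obtain w t where [simp]: "x = (w, t)" by force
    have "dist w u < r" "dist t 0 < r"
      using dist_fst_le[of x "(u,0)"] dist_snd_le[of x "(u,0)"] x(2) by auto
    then show "P x"
      using r(2)[of w t] x by (auto simp: dist_commute)
  qed (use r in auto)
qed

lemma locally_lipschitz_ball:
  assumes "locally_lipschitz \<phi>"
  obtains e L where "e > 0" "L \<ge> 0"
    "\<And>x y. x \<in> ball u e \<Longrightarrow> y \<in> ball u e \<Longrightarrow> \<bar>\<phi> x - \<phi> y\<bar> \<le> L * dist x y"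
proof -
  obtain e L where eL: "e > 0" "\<forall>x\<in>ball u e. \<forall>y\<in>ball u e. \<bar>\<phi> x - \<phi> y\<bar> \<le> L * dist x y"
    using assms unfolding locally_lipschitz_def by blast
  have "\<bar>\<phi> x - \<phi> y\<bar> \<le> \<bar>L\<bar> * dist x y" if "x \<in> ball u e" "y \<in> ball u e" for x y
  proof -
    have "\<bar>\<phi> x - \<phi> y\<bar> \<le> L * dist x y" using eL(2) that by blast
    also have "\<dots> \<le> \<bar>L\<bar> * dist x y" by (intro mult_right_mono) auto
    finally show ?thesis .
  qed
  then show thesis
    using eL(1) by (intro that[of e "\<bar>L\<bar>"]) auto
qed

lemma locally_lipschitz_continuous_on:
  assumes "locally_lipschitz \<phi>"
  shows "continuous_on A \<phi>"
proof -
  have "isCont \<phi> u" for u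
  proof -
    obtain e L where eL: "e > 0" "L \<ge> 0"
      "\<And>x y. x \<in> ball u e \<Longrightarrow> y \<in> ball u e \<Longrightarrow> \<bar>\<phi> x - \<phi> y\<bar> \<le> L * dist x y"
      using locally_lipschitz_ball[OF assms] by metis
    have "L-lipschitz_on (ball u e) \<phi>"
      using eL by (intro lipschitz_onI) (auto simp: dist_real_def)
    then have "continuous_on (ball u e) \<phi>"
      by (rule lipschitz_on_continuous_on)
    then show ?thesis
      using eL(1) continuous_on_eq_continuous_at[of "ball u e" \<phi>] by auto
  qed
  then show ?thesis
    by (simp add: continuous_at_imp_continuous_on)
qed

text \<open>The order of the quantifiers is the point: \<open>L\<close> depends on \<open>u\<close>
  alone, only the radius on \<open>v\<close>. So the Clarke derivative at \<open>u\<close> is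
  bounded by a fixed multiple of \<open>norm v\<close>.\<close>

lemma locally_lipschitz_increment_bound:
  assumes "locally_lipschitz \<phi>"
  obtains L where "L \<ge> 0"
    "\<And>v. \<exists>r>0. \<forall>w\<in>ball u r. \<forall>t\<in>{0<..<r}. \<bar>\<phi> (w + t *\<^sub>R v) - \<phi> w\<bar> \<le> L * norm v * t"
proof -
  obtain e L where eL: "e > 0" "L \<ge> 0"
      "\<And>x y. x \<in> ball u e \<Longrightarrow> y \<in> ball u e \<Longrightarrow> \<bar>\<phi> x - \<phi> y\<bar> \<le> L * dist x y"
    using locally_lipschitz_ball[OF assms] by metis
  have "\<exists>r>0. \<forall>w\<in>ball u r. \<forall>t\<in>{0<..<r}. \<bar>\<phi> (w + t *\<^sub>R v) - \<phi> w\<bar> \<le> L * norm v * t" for v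
  proof -
    define r where "r = e / (2 * (1 + norm v))"
    have r: "r > 0" "r \<le> e / 2" "r * norm v \<le> e / 2"
      using eL(1) by (auto simp: r_def field_simps add_pos_nonneg)
    have "\<bar>\<phi> (w + t *\<^sub>R v) - \<phi> w\<bar> \<le> L * norm v * t" if "w \<in> ball u r" "t \<in> {0<..<r}" for w t
    proof -
      have "t * norm v \<le> r * norm v"
        using that by (intro mult_right_mono) auto
      moreover have "dist u (w + t *\<^sub>R v) \<le> dist u w + t * norm v"
        using that norm_triangle_ineq4[of "u - w" "t *\<^sub>R v"] by (simp add: dist_norm algebra_simps)
      ultimately have "\<bar>\<phi> (w + t *\<^sub>R v) - \<phi> w\<bar> \<le> L * dist (w + t *\<^sub>R v) w"
        using that r by (intro eL(3)) auto
      then show ?thesis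
        using that by (simp add: dist_norm mult_ac)
    qed
    then show ?thesis using r(1) by blast
  qed
  then show thesis using that eL(2) by blast
qed

text \<open>The quotients are bounded near \<open>(u, 0)\<close>, so the \<open>Limsup\<close> is finite and
  \<open>real_of_ereal\<close> does not return a junk value.\<close>

lemma Limsup_quotient_eq_clarke_dd:
  assumes "locally_lipschitz \<phi>"
  shows "Limsup (at (u, 0) within (UNIV \<times> {0<..}))
    (\<lambda>(w, t). ereal ((\<phi> (w + t *\<^sub>R v) - \<phi> w) / t)) = ereal (clarke_dd \<phi> u v)"
proof -
  let ?F = "at (u, 0::real) within (UNIV \<times> {0<..})"
  let ?q = "\<lambda>(w, t). ereal ((\<phi> (w + t *\<^sub>R v) - \<phi> w) / t)"
  obtain L where "L \<ge> 0" and
    "\<And>v. \<exists>r>0. \<forall>w\<in>ball u r. \<forall>t\<in>{0<..<r}. \<bar>\<phi> (w + t *\<^sub>R v) - \<phi> w\<bar> \<le> L * norm v * t"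
    using locally_lipschitz_increment_bound[OF assms] by metis
  then obtain r where r: "r > 0" and
    le: "\<And>w t. w \<in> ball u r \<Longrightarrow> t \<in> {0<..<r} \<Longrightarrow> \<bar>\<phi> (w + t *\<^sub>R v) - \<phi> w\<bar> \<le> L * norm v * t"
    by meson
  have bd: "\<bar>(\<phi> (w + t *\<^sub>R v) - \<phi> w) / t\<bar> \<le> L * norm v" if "w \<in> ball u r" "t \<in> {0<..<r}" for w t
    using le[OF that] that(2) by (simp add: divide_le_eq)
  have ne: "?F \<noteq> bot"
  proof
    assume "?F = bot"
    then have "eventually (\<lambda>_. False) ?F" by simp
    then obtain s :: real where "s > 0" "\<forall>w\<in>ball u s. \<forall>t\<in>{0<..<s}. False"
      unfolding eventually_clarke_filter by blast
    then show False by (metis centre_in_ball dense greaterThanLessThan_iff)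
  qed
  have ev: "eventually (\<lambda>x. ?q x \<le> ereal (L * norm v)) ?F"
    "eventually (\<lambda>x. ereal (- (L * norm v)) \<le> ?q x) ?F"
    unfolding eventually_clarke_filter prod.case ereal_less_eq
    using bd r abs_le_D1 abs_le_D2 minus_le_iff by meson+
  have "Limsup ?F ?q \<le> ereal (L * norm v)"
    using ev(1) by (rule Limsup_bounded)
  moreover have "ereal (- (L * norm v)) \<le> Limsup ?F ?q"
    using Liminf_bounded[OF ev(2)] Liminf_le_Limsup[OF ne, of ?q] by (rule order_trans)
  ultimately have "\<bar>Limsup ?F ?q\<bar> \<noteq> \<infinity>"
    by auto
  then show ?thesis
    unfolding clarke_dd_def by (simp add: ereal_real)
qed

text \<open>Together with \<open>clarke_dd_leI\<close> this is the only access to the limsup from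
  here on: strict upper bounds hold uniformly near \<open>(u, 0)\<close>, and non-strict uniform
  bounds pass back to the limsup.\<close>

lemma clarke_dd_lessD:
  assumes "locally_lipschitz \<phi>" "clarke_dd \<phi> u v < k"
  obtains r where "r > 0"
    "\<And>w t. w \<in> ball u r \<Longrightarrow> t \<in> {0<..<r} \<Longrightarrow> \<phi> (w + t *\<^sub>R v) - \<phi> w < k * t"
proof -
  have "eventually (\<lambda>x. (\<lambda>(w, t). ereal ((\<phi> (w + t *\<^sub>R v) - \<phi> w) / t)) x < ereal k)
     (at (u, 0) within (UNIV \<times> {0<..}))"
    using assms Limsup_quotient_eq_clarke_dd[OF assms(1), of u v]
    by (intro Limsup_lessD) simp
  then obtain r where "r > 0"
    "\<forall>w\<in>ball u r. \<forall>t\<in>{0<..<r}. (\<phi> (w + t *\<^sub>R v) - \<phi> w) / t < k"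
    unfolding eventually_clarke_filter by auto
  then show thesis
    by (intro that[of r]) (force simp: field_simps)+
qed

lemma clarke_dd_leI:
  assumes "locally_lipschitz \<phi>" "r > 0"
    "\<And>w t. w \<in> ball u r \<Longrightarrow> t \<in> {0<..<r} \<Longrightarrow> \<phi> (w + t *\<^sub>R v) - \<phi> w \<le> k * t"
  shows "clarke_dd \<phi> u v \<le> k"
proof -
  have "eventually (\<lambda>x. (\<lambda>(w, t). ereal ((\<phi> (w + t *\<^sub>R v) - \<phi> w) / t)) x \<le> ereal k)
     (at (u, 0) within (UNIV \<times> {0<..}))"
    unfolding eventually_clarke_filter using assms(2,3)
    by (intro exI[of _ r]) (auto simp: divide_le_eq)
  then have "ereal (clarke_dd \<phi> u v) \<le> ereal k"
    unfolding Limsup_quotient_eq_clarke_dd[OF assms(1), of u v, symmetric]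
    by (rule Limsup_bounded)
  then show ?thesis by simp
qed

text \<open>The limsup also moves the base point, so a bound on \<open>ball u r\<close> contains a
  bound on a ball around every \<open>w\<close> near \<open>u\<close>. The intermediate
  \<open>k'\<close> restores the strictness lost in the limsup.\<close>

lemma clarke_dd_usc:
  assumes "locally_lipschitz \<phi>" "clarke_dd \<phi> u v < k"
  obtains r where "r > 0" "\<And>w. w \<in> ball u r \<Longrightarrow> clarke_dd \<phi> w v < k"
proof -
  obtain k' where k': "clarke_dd \<phi> u v < k'" "k' < k"
    using assms(2) dense by blast
  obtain r where r: "r > 0"
    "\<And>w t. w \<in> ball u r \<Longrightarrow> t \<in> {0<..<r} \<Longrightarrow> \<phi> (w + t *\<^sub>R v) - \<phi> w < k' * t"
    using clarke_dd_lessD[OF assms(1) k'(1)] by metis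
  have "clarke_dd \<phi> w v \<le> k'" if w: "w \<in> ball u (r/2)" for w
  proof (rule clarke_dd_leI[OF assms(1)])
    fix w' t assume "w' \<in> ball w (r/2)" "t \<in> {0<..<r/2}"
    then have "w' \<in> ball u r" "t \<in> {0<..<r}"
      using w dist_triangle[of u w' w] by auto
    then show "\<phi> (w' + t *\<^sub>R v) - \<phi> w' \<le> k' * t"
      using r(2) by force
  qed (use r in auto)
  then show thesis
    using that[of "r/2"] r(1) k'(2) by force
qed

lemma clarke_dd_lipschitz_bound:
  assumes "locally_lipschitz \<phi>"
  obtains L where "L \<ge> 0" "\<And>v. clarke_dd \<phi> u v \<le> L * norm v"
proof -
  obtain L where L: "L \<ge> 0"
    "\<And>v. \<exists>r>0. \<forall>w\<in>ball u r. \<forall>t\<in>{0<..<r}. \<bar>\<phi> (w + t *\<^sub>R v) - \<phi> w\<bar> \<le> L * norm v * t"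
    using locally_lipschitz_increment_bound[OF assms] by metis
  have "clarke_dd \<phi> u v \<le> L * norm v" for v
  proof -
    obtain r where "r > 0"
      "\<And>w t. w \<in> ball u r \<Longrightarrow> t \<in> {0<..<r} \<Longrightarrow> \<bar>\<phi> (w + t *\<^sub>R v) - \<phi> w\<bar> \<le> L * norm v * t"
      using L(2)[of v] by blast
    then show ?thesis
      by (intro clarke_dd_leI[OF assms]) (auto simp: abs_le_iff)
  qed
  then show thesis using that L(1) by blast
qed

section \<open>Sublinear functionals and the Hahn-Banach theorem\<close>

text \<open>Homogeneity is asked only as an inequality for positive factors, the form that limsups
  and infima deliver. Applying it to \<open>inverse t\<close> as well gives equality.\<close>

definition sublinear :: "('a::real_vector \<Rightarrow> real) \<Rightarrow> bool" where
  "sublinear p \<longleftrightarrow> (\<forall>x y. p (x + y) \<le> p x + p y) \<and> (\<forall>t>0. \<forall>x. p (t *\<^sub>R x) \<le> t * p x)"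

lemma sublinear_add: "sublinear p \<Longrightarrow> p (x + y) \<le> p x + p y"
  by (simp add: sublinear_def)

lemma sublinear_zero: 
  assumes "sublinear p" shows "p 0 = 0"
proof -
  \<comment> \<open>The factor 2 gives \<open>0 \<le> p 0\<close>, the factor 1/2 gives
    \<open>p 0 \<le> 0\<close>.\<close>
  have "p (2 *\<^sub>R 0) \<le> 2 * p 0" "p ((1/2) *\<^sub>R 0) \<le> (1/2) * p 0"
    using assms unfolding sublinear_def by (blast intro: zero_less_numeral half_gt_zero zero_less_one)+
  then show ?thesis by simp
qed

lemma sublinear_scaleR:
  assumes "sublinear p" "t \<ge> 0" shows "p (t *\<^sub>R x) = t * p x"
proof (cases "t = 0")
  case False
  then have t: "t > 0" using assms by simp
  have "p (inverse t *\<^sub>R (t *\<^sub>R x)) \<le> inverse t * p (t *\<^sub>R x)"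
    using assms(1) t unfolding sublinear_def by (metis inverse_positive_iff_positive)
  then have "t * p x \<le> p (t *\<^sub>R x)"
    using t by (simp add: field_simps)
  moreover have "p (t *\<^sub>R x) \<le> t * p x"
    using assms(1) t unfolding sublinear_def by blast
  ultimately show ?thesis by simp
qed (use sublinear_zero assms in auto)

lemma sublinear_minus: "sublinear p \<Longrightarrow> - p (- x) \<le> p x"
  using sublinear_add[of p x "- x"] sublinear_zero[of p] by simp

lemma sublinear_sum:
  assumes "sublinear p"
  shows "p (sum f A) \<le> (\<Sum>i\<in>A. p (f i))"
proof (induction A rule: infinite_finite_induct)
  case (insert x F)
  then show ?case
    using sublinear_add[OF assms, of "f x" "sum f F"] by simp
qed (auto simp: sublinear_zero[OF assms])

text \<open>The members \<open>q i\<close> need not be sublinear themselves; it is enough that sums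
  and dilations are dominated within the family. This covers chains, the one-parameter modifications
  in the linearity proof and infimal convolutions alike.\<close>

lemma sublinear_INF:
  fixes q :: "'i \<Rightarrow> 'a::real_vector \<Rightarrow> real"
  assumes ne: "I \<noteq> {}"
    and bd: "\<And>x. bdd_below ((\<lambda>i. q i x) ` I)"
    and add: "\<And>i j x y. i \<in> I \<Longrightarrow> j \<in> I \<Longrightarrow> \<exists>k\<in>I. q k (x + y) \<le> q i x + q j y"
    and scale: "\<And>i t x. i \<in> I \<Longrightarrow> t > 0 \<Longrightarrow> \<exists>k\<in>I. q k (t *\<^sub>R x) \<le> t * q i x"
  shows "sublinear (\<lambda>x. INF i\<in>I. q i x)"
  unfolding sublinear_def
proof (intro conjI allI impI)
  fix x y
  have "(INF i\<in>I. q i (x + y)) - q j y \<le> (INF i\<in>I. q i x)" if j: "j \<in> I" for j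
  proof (rule cINF_greatest[OF ne])
    fix i assume "i \<in> I"
    then obtain k where "k \<in> I" "q k (x + y) \<le> q i x + q j y" using add j by blast
    then show "(INF i\<in>I. q i (x + y)) - q j y \<le> q i x"
      using cINF_lower[OF bd, of k "x + y"] by linarith
  qed
  then have "(INF i\<in>I. q i (x + y)) - (INF i\<in>I. q i x) \<le> q j y" if "j \<in> I" for j
    using that by fastforce
  then have "(INF i\<in>I. q i (x + y)) - (INF i\<in>I. q i x) \<le> (INF j\<in>I. q j y)"
    by (rule cINF_greatest[OF ne])
  then show "(INF i\<in>I. q i (x + y)) \<le> (INF i\<in>I. q i x) + (INF i\<in>I. q i y)"
    by simp
next
  fix t :: real and x assume t: "t > 0"
  have "(INF i\<in>I. q i (t *\<^sub>R x)) / t \<le> (INF i\<in>I. q i x)"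
  proof (rule cINF_greatest[OF ne])
    fix i assume "i \<in> I"
    then obtain k where "k \<in> I" "q k (t *\<^sub>R x) \<le> t * q i x" using scale t by blast
    then have "(INF i\<in>I. q i (t *\<^sub>R x)) \<le> t * q i x"
      using cINF_lower[OF bd, of k "t *\<^sub>R x"] by linarith
    then show "(INF i\<in>I. q i (t *\<^sub>R x)) / t \<le> q i x"
      using t by (simp add: field_simps)
  qed
  then show "(INF i\<in>I. q i (t *\<^sub>R x)) \<le> t * (INF i\<in>I. q i x)"
    using t by (simp add: field_simps)
qed

text \<open>Replacing a minimal sublinear \<open>q\<close> by \<open>x \<mapsto> inf\<^bsub>t \<ge> 0\<^esub> (q (x + t y) - t q y)\<close>
  cannot make it smaller, whence \<open>q x + q y \<le> q (x + y)\<close>.\<close>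

lemma minimal_sublinear_imp_linear:
  assumes q: "sublinear q"
    and min: "\<And>q'. sublinear q' \<Longrightarrow> (\<And>x. q' x \<le> q x) \<Longrightarrow> q' = q"
  shows "linear q"
proof -
  have "q x + q y \<le> q (x + y)" for x y
  proof -
    define g where "g t x = q (x + t *\<^sub>R y) - t * q y" for t x
    have lower: "- q (- x) \<le> g t x" if "t \<ge> 0" for t x
      using sublinear_add[OF q, of "x + t *\<^sub>R y" "- x"] sublinear_scaleR[OF q that, of y]
      by (simp add: g_def)
    have bd: "bdd_below ((\<lambda>t. g t x) ` {0..})" for x
      using lower by (intro bdd_belowI[of _ "- q (- x)"]) auto
    have "sublinear (\<lambda>x. INF t\<in>{0..}. g t x)"
    proof (rule sublinear_INF[OF _ bd])
      fix i j :: real and x y' assume "i \<in> {0..}" "j \<in> {0..}"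
      then show "\<exists>k\<in>{0..}. g k (x + y') \<le> g i x + g j y'"
        using sublinear_add[OF q, of "x + i *\<^sub>R y" "y' + j *\<^sub>R y"]
        by (intro bexI[of _ "i + j"]) (auto simp: g_def algebra_simps)
    next
      fix i t :: real and x assume "i \<in> {0..}" "t > 0"
      then show "\<exists>k\<in>{0..}. g k (t *\<^sub>R x) \<le> t * g i x"
        using sublinear_scaleR[OF q, of t "x + i *\<^sub>R y"]
        by (intro bexI[of _ "t * i"]) (auto simp: g_def algebra_simps)
    qed auto
    moreover have "(INF t\<in>{0..}. g t x) \<le> q x" for x
      using cINF_lower[OF bd, of 0 x] by (simp add: g_def)
    ultimately have "(\<lambda>x. INF t\<in>{0..}. g t x) = q"
      by (rule min)
    then have "q x = (INF t\<in>{0..}. g t x)" by metis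
    also have "\<dots> \<le> g 1 x" by (rule cINF_lower[OF bd]) auto
    finally show ?thesis by (simp add: g_def)
  qed
  then have add: "q (x + y) = q x + q y" for x y
    using sublinear_add[OF q, of x y] by (intro antisym) auto
  have neg: "q (- x) = - q x" for x
    using add[of x "- x"] sublinear_zero[OF q] by simp
  have "q (t *\<^sub>R x) = t * q x" for t x
  proof (cases "t \<ge> 0")
    case False
    then show ?thesis
      using sublinear_scaleR[OF q, of "- t" x] neg[of "t *\<^sub>R x"] by simp
  qed (use sublinear_scaleR[OF q] in auto)
  then show ?thesis
    using add by (intro linearI) auto
qed

text \<open>Zorn's lemma runs over the sublinear functionals below \<open>p\<close> on the whole
  space rather than over partial linear extensions. A chain is bounded by its pointwise infimum,
  finite because \<open>- p (- x)\<close> is a common lower bound, and a minimal element is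
  linear.\<close>

theorem hahn_banach_sublinear:
  fixes p :: "'a::real_vector \<Rightarrow> real"
  assumes p: "sublinear p"
  obtains f where "linear f" "\<And>x. f x \<le> p x"
proof -
  define A where "A = {q. sublinear q \<and> (\<forall>x. q x \<le> p x)}"
  \<comment> \<open>The order is reversed: \<open>predicate_Zorn\<close> produces maximal elements,
    and a pointwise minimal functional is wanted.\<close>
  define P where "P = (\<lambda>q q' :: 'a \<Rightarrow> real. q' \<le> q)"
  have "\<exists>m\<in>A. \<forall>q\<in>A. P m q \<longrightarrow> q = m"
  proof (rule predicate_Zorn)
    show "partial_order_on A (relation_of P A)"
      unfolding partial_order_on_def preorder_on_def relation_of_def P_def
      by (auto simp: refl_on_def trans_def antisym_def)
  next
    fix C assume C: "C \<in> Chains (relation_of P A)"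
    have CA: "C \<subseteq> A" and chain: "\<And>q q'. q \<in> C \<Longrightarrow> q' \<in> C \<Longrightarrow> q \<le> q' \<or> q' \<le> q"
      using C unfolding Chains_def relation_of_def P_def by blast+
    show "\<exists>u\<in>A. \<forall>q\<in>C. P q u"
    proof (cases "C = {}")
      case True
      then show ?thesis using p by (auto simp: A_def)
    next
      case False
      have sub: "sublinear q" "\<And>x. q x \<le> p x" if "q \<in> C" for q
        using CA that by (auto simp: A_def)
      have bd: "bdd_below ((\<lambda>q. q x) ` C)" for x
      proof (intro bdd_belowI2[of _ "- p (- x)"])
        fix q assume "q \<in> C"
        then show "- p (- x) \<le> q x"
          using sub[of q] sublinear_minus[of q x] by (smt (verit))
      qed
      define l where "l x = (INF q\<in>C. q x)" for x
      have "sublinear l"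
        unfolding l_def
      proof (rule sublinear_INF[OF False bd])
        fix i j x y assume ij: "i \<in> C" "j \<in> C"
        define k where "k = (if i \<le> j then i else j)"
        have k: "k \<in> C" "k \<le> i" "k \<le> j" using chain[OF ij] ij by (auto simp: k_def)
        have "k (x + y) \<le> k x + k y" using sublinear_add sub k by blast
        also have "\<dots> \<le> i x + j y" using k by (intro add_mono) (auto simp: le_fun_def)
        finally show "\<exists>k\<in>C. k (x + y) \<le> i x + j y" using k by blast
      next
        fix i x and t :: real assume "i \<in> C" "t > 0"
        then show "\<exists>k\<in>C. k (t *\<^sub>R x) \<le> t * i x"
          using sub sublinear_scaleR[of i t x] by (intro bexI[of _ i]) auto
      qed
      moreover have le: "l x \<le> q x" if "q \<in> C" for q x
        unfolding l_def by (rule cINF_lower[OF bd that])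
      moreover have "l x \<le> p x" for x
      proof -
        obtain q where "q \<in> C" using False by blast
        then show ?thesis using le[of q x] sub(2)[of q x] by linarith
      qed
      ultimately show ?thesis
        by (intro bexI[of _ l]) (auto simp: A_def P_def le_fun_def)
    qed
  qed
  then obtain m where m: "m \<in> A" "\<And>q. q \<in> A \<Longrightarrow> q \<le> m \<Longrightarrow> q = m"
    by (auto simp: P_def)
  have "linear m"
  proof (rule minimal_sublinear_imp_linear)
    fix q assume q: "sublinear q" "\<And>x. q x \<le> m x"
    then have "q \<in> A" using m(1) unfolding A_def by (auto intro: order_trans)
    then show "q = m" using q m(2) by (auto simp: le_fun_def)
  qed (use m in \<open>auto simp: A_def\<close>)
  then show thesis using that m(1) by (auto simp: A_def)
qed

text \<open>The functional is found below the infimal convolution of \<open>p\<close> and \<open>c * norm\<close>.\<close>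

lemma sublinear_dominates_bounded_functional:
  fixes p :: "'a::real_normed_vector \<Rightarrow> real"
  assumes p: "sublinear p" and c: "c \<ge> 0" and lower: "\<And>v. - (c * norm v) \<le> p v"
  obtains f :: "'a \<Rightarrow>\<^sub>L real" where "\<And>v. blinfun_apply f v \<le> p v" "norm f \<le> c"
proof -
  define g where "g w v = p w + c * norm (v - w)" for w v
  have glow: "- (c * norm v) \<le> g w v" for w v
  proof -
    have "norm w \<le> norm v + norm (v - w)"
      using norm_triangle_sub[of w v] by (simp add: norm_minus_commute)
    then have "c * norm w \<le> c * (norm v + norm (v - w))"
      using c by (rule mult_left_mono)
    then show ?thesis using lower[of w] by (simp add: g_def algebra_simps)
  qed
  have bd: "bdd_below (range (\<lambda>w. g w v))" for v
    using glow by (intro bdd_belowI2[of _ "- (c * norm v)"]) auto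
  have "sublinear (\<lambda>v. INF w. g w v)"
  proof (rule sublinear_INF[OF _ bd])
    fix i j x y :: 'a
    have "c * norm (x + y - (i + j)) \<le> c * (norm (x - i) + norm (y - j))"
      using c norm_triangle_ineq[of "x - i" "y - j"]
      by (intro mult_left_mono) (auto simp: algebra_simps)
    then show "\<exists>k\<in>UNIV. g k (x + y) \<le> g i x + g j y"
      using sublinear_add[OF p, of i j]
      by (intro bexI[of _ "i + j"]) (auto simp: g_def algebra_simps)
  next
    fix i x :: 'a and t :: real assume t: "t > 0"
    have "norm (t *\<^sub>R x - t *\<^sub>R i) = t * norm (x - i)"
      using t by (metis abs_of_pos norm_scaleR scaleR_diff_right)
    then show "\<exists>k\<in>UNIV. g k (t *\<^sub>R x) \<le> t * g i x"
      using sublinear_scaleR[OF p, of t i] t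
      by (intro bexI[of _ "t *\<^sub>R i"]) (auto simp: g_def algebra_simps)
  qed auto
  then obtain f where f: "linear f" "\<And>v. f v \<le> (INF w. g w v)"
    using hahn_banach_sublinear by metis
  have le: "f v \<le> g w v" for v w
    using f(2)[of v] cINF_lower[OF bd, of w v] by (meson UNIV_I order_trans)
  \<comment> \<open>In the infimal convolution, \<open>w = v\<close> yields the bound by
    \<open>p\<close> and \<open>w = 0\<close> the bound by \<open>c * norm v\<close>.\<close>
  have fp: "f v \<le> p v" for v
    using le[of v v] by (simp add: g_def)
  have fc: "f v \<le> c * norm v" for v
    using le[of v 0] by (simp add: g_def sublinear_zero[OF p])
  have fn: "norm (f v) \<le> c * norm v" for v
    using fc[of v] fc[of "- v"] linear_neg[OF f(1), of v] by (simp add: abs_le_iff)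
  have bl: "bounded_linear f"
    by (rule bounded_linear_intro[of _ c])
       (use f(1) fn in \<open>auto simp: linear_add linear_scale mult.commute\<close>)
  show thesis
  proof (rule that[of "Blinfun f"])
    show "blinfun_apply (Blinfun f) v \<le> p v" for v
      using fp by (simp add: bounded_linear_Blinfun_apply[OF bl])
    show "norm (Blinfun f) \<le> c"
      using fn c by (intro norm_blinfun_bound) (auto simp: bounded_linear_Blinfun_apply[OF bl])
  qed
qed

section \<open>Critical points\<close>

text \<open>Subadditivity splits the increment at \<open>w + t *\<^sub>R v1\<close>. The shifted
  base point is again close to \<open>u\<close>, and the limsup runs over all base points near
  \<open>u\<close>, so the bound for \<open>v2\<close> still applies there.\<close>

lemma sublinear_clarke_dd:
  assumes lip: "locally_lipschitz \<phi>"
  shows "sublinear (clarke_dd \<phi> u)"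
  unfolding sublinear_def
proof (intro conjI allI impI)
  fix v1 v2
  show "clarke_dd \<phi> u (v1 + v2) \<le> clarke_dd \<phi> u v1 + clarke_dd \<phi> u v2"
  proof (rule field_le_epsilon)
    fix e :: real assume e: "e > 0"
    obtain r1 where r1: "r1 > 0" "\<And>w t. w \<in> ball u r1 \<Longrightarrow> t \<in> {0<..<r1} \<Longrightarrow>
        \<phi> (w + t *\<^sub>R v1) - \<phi> w < (clarke_dd \<phi> u v1 + e/2) * t"
      using clarke_dd_lessD[OF lip, of u v1 "clarke_dd \<phi> u v1 + e/2"] e by auto
    obtain r2 where r2: "r2 > 0" "\<And>w t. w \<in> ball u r2 \<Longrightarrow> t \<in> {0<..<r2} \<Longrightarrow>
        \<phi> (w + t *\<^sub>R v2) - \<phi> w < (clarke_dd \<phi> u v2 + e/2) * t"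
      using clarke_dd_lessD[OF lip, of u v2 "clarke_dd \<phi> u v2 + e/2"] e by auto
    define r where "r = min r1 (r2 / (2 * (1 + norm v1)))"
    have r: "r > 0" "r \<le> r1" "r \<le> r2 / (2 * (1 + norm v1))"
      using r1(1) r2(1) by (auto simp: r_def add_pos_nonneg)
    then have "r * (1 + norm v1) \<le> r2 / 2"
      by (simp add: field_simps add_pos_nonneg)
    then have r': "r \<le> r2 / 2" "r * norm v1 \<le> r2 / 2"
      using r(1) by (auto simp: algebra_simps) (smt (verit) mult_nonneg_nonneg norm_ge_zero)
    show "clarke_dd \<phi> u (v1 + v2) \<le> clarke_dd \<phi> u v1 + clarke_dd \<phi> u v2 + e"
    proof (rule clarke_dd_leI[OF lip r(1)])
      fix w t assume that: "w \<in> ball u r" "t \<in> {0<..<r}"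
      have "t * norm v1 \<le> r * norm v1"
        using that by (intro mult_right_mono) auto
      moreover have "dist u (w + t *\<^sub>R v1) \<le> dist u w + t * norm v1"
        using that norm_triangle_ineq4[of "u - w" "t *\<^sub>R v1"] by (simp add: dist_norm algebra_simps)
      ultimately have "w + t *\<^sub>R v1 \<in> ball u r2"
        using that r' by auto
      then have "\<phi> (w + t *\<^sub>R v1 + t *\<^sub>R v2) - \<phi> (w + t *\<^sub>R v1) < (clarke_dd \<phi> u v2 + e/2) * t"
        using that r r' r2(1) by (intro r2(2)) auto
      moreover have "\<phi> (w + t *\<^sub>R v1) - \<phi> w < (clarke_dd \<phi> u v1 + e/2) * t"
        using that r by (intro r1(2)) auto
      ultimately show "\<phi> (w + t *\<^sub>R (v1 + v2)) - \<phi> w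
          \<le> (clarke_dd \<phi> u v1 + clarke_dd \<phi> u v2 + e) * t"
        by (simp add: algebra_simps)
    qed
  qed
next
  fix s :: real and v assume s: "s > 0"
  show "clarke_dd \<phi> u (s *\<^sub>R v) \<le> s * clarke_dd \<phi> u v"
  proof (rule field_le_epsilon)
    fix e :: real assume e: "e > 0"
    obtain r1 where r1: "r1 > 0" "\<And>w t. w \<in> ball u r1 \<Longrightarrow> t \<in> {0<..<r1} \<Longrightarrow>
        \<phi> (w + t *\<^sub>R v) - \<phi> w < (clarke_dd \<phi> u v + e/s) * t"
      using clarke_dd_lessD[OF lip, of u v "clarke_dd \<phi> u v + e/s"] e s by auto
    show "clarke_dd \<phi> u (s *\<^sub>R v) \<le> s * clarke_dd \<phi> u v + e"
    proof (rule clarke_dd_leI[OF lip])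
      show "min r1 (r1/s) > 0" using r1 s by auto
      fix w t assume "w \<in> ball u (min r1 (r1/s))" "t \<in> {0<..<min r1 (r1/s)}"
      then have "\<phi> (w + (t * s) *\<^sub>R v) - \<phi> w < (clarke_dd \<phi> u v + e/s) * (t * s)"
        using s by (intro r1(2)) (auto simp: field_simps)
      then show "\<phi> (w + t *\<^sub>R s *\<^sub>R v) - \<phi> w \<le> (s * clarke_dd \<phi> u v + e) * t"
        using s by (simp add: algebra_simps)
    qed
  qed
qed

lemma clarke_dd_diff_le:
  assumes lip: "locally_lipschitz \<phi>"
  obtains L where "L \<ge> 0" "\<And>v w. \<bar>clarke_dd \<phi> u v - clarke_dd \<phi> u w\<bar> \<le> L * norm (v - w)"
proof -
  obtain L where L: "L \<ge> 0" "\<And>v. clarke_dd \<phi> u v \<le> L * norm v"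
    using clarke_dd_lipschitz_bound[OF lip] by metis
  have "clarke_dd \<phi> u v - clarke_dd \<phi> u w \<le> L * norm (v - w)" for v w
    using sublinear_add[OF sublinear_clarke_dd[OF lip], of u "v - w" w] L(2)[of "v - w"] by simp
  then have "\<bar>clarke_dd \<phi> u v - clarke_dd \<phi> u w\<bar> \<le> L * norm (v - w)" for v w
    by (smt (verit) norm_minus_commute)
  then show thesis
    using L(1) that by blast
qed

text \<open>Continuity in the direction for a fixed base point, as required for passing to the limit
  in a series of directions.\<close>

lemma continuous_on_clarke_dd:
  assumes "locally_lipschitz \<phi>"
  shows "continuous_on A (clarke_dd \<phi> u)"
proof -
  obtain L where L: "L \<ge> 0" "\<And>v w. \<bar>clarke_dd \<phi> u v - clarke_dd \<phi> u w\<bar> \<le> L * norm (v - w)"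
    using clarke_dd_diff_le[OF assms] by metis
  have "L-lipschitz_on A (clarke_dd \<phi> u)"
    using L by (intro lipschitz_onI) (auto simp: dist_real_def dist_norm)
  then show ?thesis by (rule lipschitz_on_continuous_on)
qed

text \<open>The direction may vary together with the base point, as it does for a continuous field.
  A change of direction by less than \<open>r\<close> alters the increment by at most
  \<open>L * r * t\<close>, which the gap \<open>k - k'\<close> absorbs.\<close>

lemma clarke_dd_less_direction:
  assumes lip: "locally_lipschitz \<phi>" and less: "clarke_dd \<phi> u v < k"
  obtains r where "r > 0" "\<And>w v' t. w \<in> ball u r \<Longrightarrow> v' \<in> ball v r \<Longrightarrow> t \<in> {0<..<r} \<Longrightarrow>
    \<phi> (w + t *\<^sub>R v') - \<phi> w < k * t"
proof -
  obtain k' where k': "clarke_dd \<phi> u v < k'" "k' < k"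
    using less dense by blast
  obtain r1 where r1: "r1 > 0"
    "\<And>w t. w \<in> ball u r1 \<Longrightarrow> t \<in> {0<..<r1} \<Longrightarrow> \<phi> (w + t *\<^sub>R v) - \<phi> w < k' * t"
    using clarke_dd_lessD[OF lip k'(1)] by metis
  obtain e L where eL: "e > 0" "L \<ge> 0"
      "\<And>x y. x \<in> ball u e \<Longrightarrow> y \<in> ball u e \<Longrightarrow> \<bar>\<phi> x - \<phi> y\<bar> \<le> L * dist x y"
    using locally_lipschitz_ball[OF lip] by metis
  define r where "r = Min {1, r1, e / (2 * (2 + norm v)), (k - k') / (1 + L)}"
  have r: "r > 0" "r \<le> 1" "r \<le> r1" "r \<le> e / (2 * (2 + norm v))" "r \<le> (k - k') / (1 + L)"
    using r1(1) k' eL by (auto simp: r_def add_pos_nonneg)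
  have re: "r * (2 + norm v) \<le> e / 2" 
    using r(4) by (simp add: field_simps add_pos_nonneg)
  have rk: "L * r \<le> k - k'"
    using r(1,5) eL(2) by (simp add: field_simps)
  show thesis
  proof (rule that[OF r(1)])
    fix w v' t assume that: "w \<in> ball u r" "v' \<in> ball v r" "t \<in> {0<..<r}"
    have in_e: "w + t *\<^sub>R x \<in> ball u e" if x: "norm x \<le> norm v + 1" for x
    proof -
      have "t * norm x \<le> r * (norm v + 1)"
        using x that r(1) \<open>t \<in> _\<close> by (intro mult_mono) auto
      moreover have "dist u (w + t *\<^sub>R x) \<le> dist u w + t * norm x"
        using \<open>t \<in> _\<close> norm_triangle_ineq4[of "u - w" "t *\<^sub>R x"] by (simp add: dist_norm algebra_simps)
      moreover have "dist u w < r" using \<open>w \<in> _\<close> by simp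
      ultimately have "dist u (w + t *\<^sub>R x) < r * (2 + norm v)"
        by (simp add: algebra_simps)
      then show ?thesis using re eL(1) by simp
    qed
    have "norm v' \<le> norm v + norm (v' - v)" by (rule norm_triangle_sub)
    then have nv': "norm v' \<le> norm v + 1"
      using that(2) r(2) by (simp add: dist_norm norm_minus_commute)
    have "\<bar>\<phi> (w + t *\<^sub>R v') - \<phi> (w + t *\<^sub>R v)\<bar> \<le> L * dist (w + t *\<^sub>R v') (w + t *\<^sub>R v)"
      using nv' by (intro eL(3) in_e) auto
    also have "dist (w + t *\<^sub>R v') (w + t *\<^sub>R v) = t * norm (v' - v)"
      using that(3) by (simp add: dist_norm flip: scaleR_diff_right)
    also have "L * (t * norm (v' - v)) \<le> L * (t * r)"
      using that eL(2) by (intro mult_left_mono) (auto simp: dist_norm norm_minus_commute)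
    also have "\<dots> \<le> (k - k') * t"
      using rk that(3) mult_right_mono[OF rk, of t] by (simp add: mult_ac)
    finally have "\<phi> (w + t *\<^sub>R v') - \<phi> (w + t *\<^sub>R v) \<le> (k - k') * t" by simp
    moreover have "\<phi> (w + t *\<^sub>R v) - \<phi> w < k' * t"
      using that r by (intro r1(2)) auto
    ultimately show "\<phi> (w + t *\<^sub>R v') - \<phi> w < k * t"
      by (simp add: algebra_simps)
  qed
qed

text \<open>Hahn-Banach enters here: a Clarke derivative above \<open>- (c * norm v)\<close>
  dominates a functional of norm at most \<open>c\<close>, which is then a subgradient. Read
  backwards, \<open>c < mnorm \<phi> u\<close> yields a direction of descent.\<close>

lemma mnorm_le_of_lower_bound:
  assumes lip: "locally_lipschitz \<phi>" and c: "c \<ge> 0" "\<And>v. - (c * norm v) \<le> clarke_dd \<phi> u v"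
  shows "mnorm \<phi> u \<le> c"
proof -
  obtain f where f: "\<And>v. blinfun_apply f v \<le> clarke_dd \<phi> u v" "norm f \<le> c"
    using sublinear_dominates_bounded_functional[OF sublinear_clarke_dd[OF lip] c] by metis
  have "mnorm \<phi> u \<le> norm f"
    unfolding mnorm_def using f(1)
    by (intro cInf_lower bdd_belowI[of _ 0]) (auto simp: clarke_subdiff_def)
  then show ?thesis using f(2) by simp
qed

text \<open>Guards \<open>mnorm\<close> against being the \<open>Inf\<close> of the empty set. The
  local Lipschitz constant serves as the norm bound.\<close>

lemma clarke_subdiff_nonempty:
  assumes "locally_lipschitz \<phi>"
  shows "clarke_subdiff \<phi> u \<noteq> {}"
proof -
  obtain L where L: "L \<ge> 0" "\<And>v. clarke_dd \<phi> u v \<le> L * norm v"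
    using clarke_dd_lipschitz_bound[OF assms] by metis
  have "- (L * norm v) \<le> clarke_dd \<phi> u v" for v
    using L(2)[of "- v"] sublinear_minus[OF sublinear_clarke_dd[OF assms], of u v] by simp
  then show ?thesis
    using sublinear_dominates_bounded_functional[OF sublinear_clarke_dd[OF assms] L(1)]
    unfolding clarke_subdiff_def by blast
qed

text \<open>Every subgradient \<open>f\<close> satisfies
  \<open>- (norm f * norm v) \<le> f v\<close>, so descent at rate \<open>c\<close> bounds all their
  norms from below. Strictness of the premise rules out \<open>v = 0\<close>.\<close>

lemma mnorm_geI:
  assumes lip: "locally_lipschitz \<phi>" and "clarke_dd \<phi> u v < - (c * norm v)"
  shows "c \<le> mnorm \<phi> u"
  unfolding mnorm_def
proof (rule cINF_greatest[OF clarke_subdiff_nonempty[OF lip]])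
  fix f assume "f \<in> clarke_subdiff \<phi> u"
  then have "blinfun_apply f v < - (c * norm v)"
    using assms(2) unfolding clarke_subdiff_def by (auto intro: le_less_trans)
  moreover have "- (norm f * norm v) \<le> blinfun_apply f v"
    using norm_blinfun[of f v] by (simp add: abs_le_iff)
  ultimately have "c * norm v < norm f * norm v" by linarith
  then show "c \<le> norm f"
    by (simp add: mult_less_cancel_right)
qed

lemma mnorm_nonneg:
  assumes "locally_lipschitz \<phi>" shows "0 \<le> mnorm \<phi> u"
  unfolding mnorm_def
  by (rule cINF_greatest[OF clarke_subdiff_nonempty[OF assms]]) simp

lemma descent_direction:
  assumes lip: "locally_lipschitz \<phi>" and "0 \<le> c" "c < mnorm \<phi> u"
  obtains v where "norm v \<le> 1" "clarke_dd \<phi> u v < - c"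
proof -
  obtain v where v: "clarke_dd \<phi> u v < - (c * norm v)"
    using mnorm_le_of_lower_bound[OF lip assms(2), of u] assms(3) by (meson not_less)
  have v0: "v \<noteq> 0" using v sublinear_zero[OF sublinear_clarke_dd[OF lip]] by auto
  have "clarke_dd \<phi> u ((1 / norm v) *\<^sub>R v) = (1 / norm v) * clarke_dd \<phi> u v"
    by (rule sublinear_scaleR[OF sublinear_clarke_dd[OF lip]]) simp
  also have "\<dots> < - c" using v v0 by (simp add: field_simps)
  finally show thesis using v0 by (intro that[of "(1 / norm v) *\<^sub>R v"]) auto
qed

text \<open>This is lower semicontinuity of \<open>mnorm\<close> in disguise: a direction of descent
  at a noncritical \<open>u\<close> keeps its rate at all nearby points, since the Clarke derivative
  is upper semicontinuous, and this keeps \<open>mnorm\<close> away from 0 there.\<close>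

lemma crit_of_mnorm_tendsto_0:
  assumes lip: "locally_lipschitz \<phi>" and y: "y \<longlonglongrightarrow> u" and m: "(\<lambda>n. mnorm \<phi> (y n)) \<longlonglongrightarrow> 0"
  shows "u \<in> crit \<phi>"
proof (rule ccontr)
  assume "u \<notin> crit \<phi>"
  then have pos: "mnorm \<phi> u > 0"
    using mnorm_nonneg[OF lip, of u] by (simp add: crit_def)
  define c where "c = mnorm \<phi> u / 2"
  have c: "c > 0" "c < mnorm \<phi> u" using pos by (auto simp: c_def)
  then obtain v where v: "norm v \<le> 1" "clarke_dd \<phi> u v < - c"
    using descent_direction[OF lip, of c u] by auto
  obtain r where r: "r > 0" "\<And>w. w \<in> ball u r \<Longrightarrow> clarke_dd \<phi> w v < - c"
    using clarke_dd_usc[OF lip v(2)] by metis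
  have "c \<le> mnorm \<phi> w" if "w \<in> ball u r" for w
  proof (rule mnorm_geI[OF lip])
    have "c * norm v \<le> c * 1" using v(1) c by (intro mult_left_mono) auto
    then show "clarke_dd \<phi> w v < - (c * norm v)" using r(2)[OF that] by simp
  qed
  moreover have "eventually (\<lambda>n. y n \<in> ball u r) sequentially"
    using y r(1) by (auto simp: tendsto_iff dist_commute)
  moreover have "eventually (\<lambda>n. mnorm \<phi> (y n) < c) sequentially"
    using m c(1) by (rule order_tendstoD)
  ultimately have "eventually (\<lambda>n::nat. False) sequentially"
    by (smt (verit, best) eventually_elim2)
  then show False by simp
qed

section \<open>Gluing descent directions\<close>

text \<open>This is the heart of Stone's paracompactness theorem: the points whose first cover
  element \<open>first x\<close> contains \<open>ball x (3 * \<rho>)\<close> split into pieces at mutual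
  distance at least \<open>3 * \<rho>\<close>.\<close>

lemma discrete_bump_family:
  fixes W :: "'a::metric_space set" and val :: "'a \<Rightarrow> 'b::real_normed_vector"
  assumes rad: "\<And>u. u \<in> W \<Longrightarrow> rad u > 0"
  obtains g :: "real \<Rightarrow> 'a \<Rightarrow> real" and c :: "real \<Rightarrow> 'a \<Rightarrow> 'a"
  where "\<And>\<rho> w. \<rho> > 0 \<Longrightarrow> 0 \<le> g \<rho> w \<and> g \<rho> w \<le> \<rho>"
    and "\<And>\<rho> w. \<rho> > 0 \<Longrightarrow> g \<rho> w > 0 \<Longrightarrow> c \<rho> w \<in> W \<and> w \<in> ball (c \<rho> w) (rad (c \<rho> w))"
    and "\<And>\<rho>. \<rho> > 0 \<Longrightarrow> continuous_on UNIV (\<lambda>w. g \<rho> w *\<^sub>R val (c \<rho> w))"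
    and "\<And>w. w \<in> W \<Longrightarrow> \<exists>e>0. \<forall>\<rho>. 0 < \<rho> \<and> \<rho> < e \<longrightarrow> g \<rho> w > 0"
proof -
  obtain R :: "('a \<times> 'a) set" where "Well_order R" and "Field R = UNIV"
    using well_ordering by metis
  then have wf: "wf (R - Id)" and tot: "\<And>x y. x \<noteq> y \<Longrightarrow> (x, y) \<in> R \<or> (y, x) \<in> R"
    unfolding well_order_on_def linear_order_on_def total_on_def by auto
  define C where "C u = ball u (rad u)" for u
  have "\<exists>z. z \<in> W \<and> x \<in> C z \<and> (\<forall>y. (y, z) \<in> R - Id \<longrightarrow> \<not> (y \<in> W \<and> x \<in> C y))" if "x \<in> W" for x
  proof -
    have "x \<in> {z \<in> W. x \<in> C z}" using that rad by (auto simp: C_def)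
    then show ?thesis
    proof (rule wfE_min[OF wf])
      fix z assume "z \<in> {z \<in> W. x \<in> C z}"
        and "\<And>y. (y, z) \<in> R - Id \<Longrightarrow> y \<notin> {z \<in> W. x \<in> C z}"
      then show ?thesis by (intro exI[of _ z]) simp
    qed
  qed
  then obtain first where first: "\<And>x. x \<in> W \<Longrightarrow> first x \<in> W" "\<And>x. x \<in> W \<Longrightarrow> x \<in> C (first x)"
    "\<And>x y. x \<in> W \<Longrightarrow> (y, first x) \<in> R - Id \<Longrightarrow> y \<in> W \<Longrightarrow> x \<notin> C y"
    by metis
  define E where "E \<rho> = {x \<in> W. ball x (3 * \<rho>) \<subseteq> C (first x)}" for \<rho>
  \<comment> \<open>If \<open>first x\<close> preceded \<open>first y\<close>, then
    \<open>y\<close>, which lies in \<open>ball x (3 * \<rho>)\<close>, would belong to a cover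
    element earlier than its first one.\<close>
  have less: False if "x \<in> E \<rho>" "y \<in> E \<rho>" "dist x y < 3 * \<rho>" "(first x, first y) \<in> R - Id" for x y \<rho>
  proof -
    have "y \<in> C (first x)" using that(1,3) by (auto simp: E_def)
    then show False using first(3)[of y "first x"] first(1)[of x] that by (auto simp: E_def)
  qed
  have same: "first x = first y" if "x \<in> E \<rho>" "y \<in> E \<rho>" "dist x y < 3 * \<rho>" for x y \<rho>
  proof (rule ccontr)
    assume "first x \<noteq> first y"
    then have "(first x, first y) \<in> R - Id \<or> (first y, first x) \<in> R - Id" using tot by auto
    then show False using less[of x \<rho> y] less[of y \<rho> x] that by (auto simp: dist_commute)
  qed
  define near where "near \<rho> w = (SOME x. x \<in> E \<rho> \<and> dist w x < \<rho>)" for \<rho> w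
  \<comment> \<open>\<open>infdist w {}\<close> is 0, so without the case distinction an empty
    \<open>E \<rho>\<close> would produce a bump of height \<rho> everywhere.\<close>
  define g where "g \<rho> w = (if E \<rho> = {} then 0 else max 0 (\<rho> - infdist w (E \<rho>)))" for \<rho> w
  have near: "near \<rho> w \<in> E \<rho> \<and> dist w (near \<rho> w) < \<rho>" if "g \<rho> w > 0" for \<rho> w
  proof -
    have ne: "E \<rho> \<noteq> {}" and "infdist w (E \<rho>) < \<rho>" using that by (auto simp: g_def split: if_splits)
    then obtain x where "x \<in> E \<rho>" "dist w x < \<rho>"
      unfolding infdist_def using cINF_less_iff[OF ne, of "dist w" \<rho>] by auto
    then show ?thesis 
      unfolding near_def using someI[of "\<lambda>x. x \<in> E \<rho> \<and> dist w x < \<rho>" x] by simp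
  qed
  have gcont: "continuous_on UNIV (g \<rho>)" for \<rho>
    unfolding g_def by (cases "E \<rho> = {}") (auto intro!: continuous_intros)
  define c where "c \<rho> w = first (near \<rho> w)" for \<rho> w
  show thesis
  proof (rule that[of g c])
    show "0 \<le> g \<rho> w \<and> g \<rho> w \<le> \<rho>" if "\<rho> > 0" for \<rho> w
      using that infdist_nonneg[of w "E \<rho>"] by (auto simp: g_def)
  next
    fix \<rho> w assume "\<rho> > 0" "g \<rho> w > 0"
    then have n: "near \<rho> w \<in> E \<rho>" "dist w (near \<rho> w) < \<rho>" using near by auto
    then have "w \<in> ball (near \<rho> w) (3 * \<rho>)" using \<open>\<rho> > 0\<close> by (simp add: dist_commute)
    then show "c \<rho> w \<in> W \<and> w \<in> ball (c \<rho> w) (rad (c \<rho> w))"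
      using n(1) first(1) unfolding c_def E_def C_def by blast
  next
    fix \<rho> :: real assume \<rho>: "\<rho> > 0"
    have "isCont (\<lambda>w. g \<rho> w *\<^sub>R val (c \<rho> w)) w0" for w0
    proof -
      define B where "B = ball w0 (\<rho>/2)"
      \<comment> \<open>The distances from \<open>w\<close> and \<open>w'\<close> to their chosen
        points and from \<open>w\<close> to \<open>w'\<close> are each below \<rho>, whence the
        factor 3 in \<open>E\<close>. Although \<open>near\<close> is an arbitrary choice, the cover
        element is thus constant on \<open>B\<close> wherever the bump is positive.\<close>
      have const: "c \<rho> w = c \<rho> w'" if "w \<in> B" "w' \<in> B" "g \<rho> w > 0" "g \<rho> w' > 0" for w w'
      proof -
        have "dist (near \<rho> w) (near \<rho> w') < 3 * \<rho>"
          using near[OF that(3)] near[OF that(4)] that(1,2)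
            dist_triangle[of "near \<rho> w" "near \<rho> w'" w] dist_triangle[of w "near \<rho> w'" w']
            dist_triangle[of w w' w0]
          by (auto simp: B_def dist_commute)
        then show ?thesis
          unfolding c_def using near[OF that(3)] near[OF that(4)] by (intro same) auto
      qed
      obtain v where v: "\<And>w. w \<in> B \<Longrightarrow> g \<rho> w > 0 \<Longrightarrow> val (c \<rho> w) = v"
      proof (cases "\<exists>w\<in>B. g \<rho> w > 0")
        case True
        then show thesis using const that by metis
      qed (use that in blast)
      have eq: "g \<rho> w *\<^sub>R v = g \<rho> w *\<^sub>R val (c \<rho> w)" if "w \<in> B" for w
        using v[OF that] by (cases "g \<rho> w > 0") (auto simp: g_def split: if_splits)
      have "continuous_on B (\<lambda>w. g \<rho> w *\<^sub>R v)"
        by (intro continuous_intros continuous_on_subset[OF gcont]) auto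
      then have "continuous_on B (\<lambda>w. g \<rho> w *\<^sub>R val (c \<rho> w))"
        using eq by (rule continuous_on_eq)
      then show ?thesis
        by (rule continuous_on_interior) (use \<rho> in \<open>simp add: B_def\<close>)
    qed
    then show "continuous_on UNIV (\<lambda>w. g \<rho> w *\<^sub>R val (c \<rho> w))"
      by (simp add: continuous_at_imp_continuous_on)
  next
    fix w assume w: "w \<in> W"
    have "open (C (first w))" by (simp add: C_def)
    then obtain e where e: "e > 0" "ball w e \<subseteq> C (first w)"
      using first(2)[OF w] open_contains_ball by blast
    have "g \<rho> w > 0" if "0 < \<rho>" "\<rho> < e / 3" for \<rho>
    proof -
      have "ball w (3 * \<rho>) \<subseteq> ball w e" using that by (intro subset_ball) simp
      then have "w \<in> E \<rho>" using e(2) w by (auto simp: E_def)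
      then show ?thesis using that by (auto simp: g_def)
    qed
    then show "\<exists>e>0. \<forall>\<rho>. 0 < \<rho> \<and> \<rho> < e \<longrightarrow> g \<rho> w > 0"
      using e(1) by (intro exI[of _ "e/3"]) auto
  qed
qed

text \<open>The bumps are added over all scales without normalisation: the inequality sought is
  positively homogeneous in \<open>V u\<close>, so a conical combination of descent directions is
  good enough. Continuity comes from uniform convergence instead of local finiteness.\<close>

lemma continuous_descent_field:
  fixes \<phi> :: "'a::banach \<Rightarrow> real"
  assumes lip: "locally_lipschitz \<phi>" and kcont: "continuous_on UNIV k"
    and knn: "\<And>u. u \<in> W \<Longrightarrow> 0 \<le> k u"
    and desc: "\<And>u. u \<in> W \<Longrightarrow> \<exists>v. norm v \<le> 1 \<and> clarke_dd \<phi> u v < - k u"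
  obtains V where "continuous_on UNIV V"
    "\<And>u. u \<in> W \<Longrightarrow> clarke_dd \<phi> u (V u) < - (k u * norm (V u))"
proof -
  have "\<exists>v r. r > 0 \<and> norm v \<le> 1 \<and> (\<forall>w\<in>ball u r. clarke_dd \<phi> w v < - k w)" if "u \<in> W" for u
  proof -
    obtain v where v: "norm v \<le> 1" "clarke_dd \<phi> u v < - k u" using desc \<open>u \<in> W\<close> by blast
    obtain k' where k': "clarke_dd \<phi> u v < k'" "k' < - k u" using v(2) dense by blast
    obtain r1 where r1: "r1 > 0" "\<And>w. w \<in> ball u r1 \<Longrightarrow> clarke_dd \<phi> w v < k'"
      using clarke_dd_usc[OF lip k'(1)] by metis
    have "open {w. k w < - k'}"
      using kcont by (intro open_Collect_less) auto
    moreover have "u \<in> {w. k w < - k'}" using k' by simp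
    ultimately obtain r2 where r2: "r2 > 0" "ball u r2 \<subseteq> {w. k w < - k'}"
      using open_contains_ball by blast
    show ?thesis
    proof (intro exI[of _ v] exI[of _ "min r1 r2"] conjI ballI)
      fix w assume "w \<in> ball u (min r1 r2)"
      then have "clarke_dd \<phi> w v < k'" "k w < - k'" using r1(2) r2(2) by auto
      then show "clarke_dd \<phi> w v < - k w" by simp
    qed (use r1 r2 v in auto)
  qed
  then obtain val rad where val: "\<And>u. u \<in> W \<Longrightarrow> rad u > 0" "\<And>u. u \<in> W \<Longrightarrow> norm (val u) \<le> 1"
    "\<And>u w. u \<in> W \<Longrightarrow> w \<in> ball u (rad u) \<Longrightarrow> clarke_dd \<phi> w (val u) < - k w"
    by metis
  obtain g c where g: "\<And>\<rho> w. \<rho> > 0 \<Longrightarrow> 0 \<le> g \<rho> w \<and> g \<rho> w \<le> \<rho>"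
    and c: "\<And>\<rho> w. \<rho> > 0 \<Longrightarrow> g \<rho> w > 0 \<Longrightarrow> c \<rho> w \<in> W \<and> w \<in> ball (c \<rho> w) (rad (c \<rho> w))"
    and cont: "\<And>\<rho>. \<rho> > 0 \<Longrightarrow> continuous_on UNIV (\<lambda>w. g \<rho> w *\<^sub>R val (c \<rho> w))"
    and cover: "\<And>w. w \<in> W \<Longrightarrow> \<exists>e>0. \<forall>\<rho>. 0 < \<rho> \<and> \<rho> < e \<longrightarrow> g \<rho> w > 0"
    by (rule discrete_bump_family[of W rad val, OF val(1)], assumption, rule that; assumption)
  \<comment> \<open>The scales are summable, for the M-test, and tend to 0, so that every point of
    \<open>W\<close> is covered at some scale.\<close>
  define \<rho> where "\<rho> n = (1/2::real) ^ n" for n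
  have \<rho>: "\<rho> n > 0" for n by (simp add: \<rho>_def)
  define f where "f n w = g (\<rho> n) w *\<^sub>R val (c (\<rho> n) w)" for n w
  have fle: "norm (f n w) \<le> g (\<rho> n) w" for n w
  proof (cases "g (\<rho> n) w > 0")
    case True
    then have "norm (val (c (\<rho> n) w)) \<le> 1" using c[OF \<rho>] val(2) by blast
    then show ?thesis using True by (simp add: f_def mult_left_le)
  next
    case False
    then have "g (\<rho> n) w = 0" using g[OF \<rho>, of n w] by linarith
    then show ?thesis by (simp add: f_def)
  qed
  have unif: "uniform_limit UNIV (\<lambda>N w. \<Sum>n<N. f n w) (\<lambda>w. \<Sum>n. f n w) sequentially"
  proof (rule Weierstrass_m_test)
    show "norm (f n w) \<le> \<rho> n" for n w using fle[of n w] g[OF \<rho>, of n w] by linarith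
    show "summable \<rho>" unfolding \<rho>_def by (rule summable_geometric) simp
  qed
  define V where "V w = (\<Sum>n. f n w)" for w
  have "continuous_on UNIV V"
    unfolding V_def
    by (rule uniform_limit_theorem[OF _ unif])
       (auto intro!: always_eventually continuous_on_sum simp: f_def cont[OF \<rho>])
  moreover have "clarke_dd \<phi> u (V u) < - (k u * norm (V u))" if u: "u \<in> W" for u
  proof -
    note sub = sublinear_clarke_dd[OF lip, of u]
    have ddf: "clarke_dd \<phi> u (f n u) \<le> - (k u * g (\<rho> n) u)"
      and ddf': "g (\<rho> n) u > 0 \<Longrightarrow> clarke_dd \<phi> u (f n u) < - (k u * g (\<rho> n) u)" for n
    proof -
      have eq: "clarke_dd \<phi> u (f n u) = g (\<rho> n) u * clarke_dd \<phi> u (val (c (\<rho> n) u))"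
        unfolding f_def using g[OF \<rho>] by (intro sublinear_scaleR[OF sub]) auto
      show strict: "clarke_dd \<phi> u (f n u) < - (k u * g (\<rho> n) u)" if "g (\<rho> n) u > 0"
      proof -
        have "clarke_dd \<phi> u (val (c (\<rho> n) u)) < - k u"
          using c[OF \<rho> that] val(3) by blast
        then have "g (\<rho> n) u * clarke_dd \<phi> u (val (c (\<rho> n) u)) < g (\<rho> n) u * (- k u)"
          using that by (intro mult_strict_left_mono)
        then show ?thesis using eq by (simp add: mult.commute)
      qed
      show "clarke_dd \<phi> u (f n u) \<le> - (k u * g (\<rho> n) u)"
        using strict eq g[OF \<rho>, of n u] by (cases "g (\<rho> n) u > 0") auto
    qed
    obtain e where e: "e > 0" "\<And>\<rho>. 0 < \<rho> \<Longrightarrow> \<rho> < e \<Longrightarrow> g \<rho> u > 0" using cover[OF u] by blast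
    obtain n0 where "\<rho> n0 < e"
      unfolding \<rho>_def using real_arch_pow_inv[OF e(1), of "1/2"] by auto
    then have n0: "g (\<rho> n0) u > 0" using e(2) \<rho> by blast
    \<comment> \<open>Strictness could be lost in the limit of the partial sums; the margin \<delta>
      of the single term \<open>n0\<close> persists in all later ones.\<close>
    define \<delta> where "\<delta> = - (k u * g (\<rho> n0) u) - clarke_dd \<phi> u (f n0 u)"
    have \<delta>: "\<delta> > 0" using ddf'[OF n0] by (simp add: \<delta>_def)
    define S where "S N = (\<Sum>n<N. f n u)" for N
    have S: "S \<longlonglongrightarrow> V u"
      unfolding S_def V_def by (rule tendsto_uniform_limitI[OF unif]) simp
    have SN: "clarke_dd \<phi> u (S N) \<le> - (k u * norm (S N)) - \<delta>" if "N > n0" for N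
    proof -
      have "clarke_dd \<phi> u (S N) \<le> (\<Sum>n<N. clarke_dd \<phi> u (f n u))"
        unfolding S_def by (rule sublinear_sum[OF sub])
      also have "\<dots> = clarke_dd \<phi> u (f n0 u) + (\<Sum>n\<in>{..<N} - {n0}. clarke_dd \<phi> u (f n u))"
        using that by (intro sum.remove) auto
      also have "\<dots> \<le> (- (k u * g (\<rho> n0) u) - \<delta>) + (\<Sum>n\<in>{..<N} - {n0}. - (k u * g (\<rho> n) u))"
        using ddf by (intro add_mono sum_mono) (auto simp: \<delta>_def)
      also have "\<dots> = (\<Sum>n<N. - (k u * g (\<rho> n) u)) - \<delta>"
        using that by (subst sum.remove[of "{..<N}" n0]) auto
      also have "\<dots> = - (k u * (\<Sum>n<N. g (\<rho> n) u)) - \<delta>"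
        by (simp add: sum_negf sum_distrib_left)
      also have "norm (S N) \<le> (\<Sum>n<N. g (\<rho> n) u)"
        unfolding S_def using fle by (intro sum_norm_le) auto
      then have "- (k u * (\<Sum>n<N. g (\<rho> n) u)) - \<delta> \<le> - (k u * norm (S N)) - \<delta>"
        using knn[OF u] by (auto intro: mult_left_mono)
      finally show ?thesis .
    qed
    have "(\<lambda>N. clarke_dd \<phi> u (S N)) \<longlonglongrightarrow> clarke_dd \<phi> u (V u)"
      using continuous_on_clarke_dd[OF lip, of UNIV u] S
      by (intro continuous_on_tendsto_compose[where f = "clarke_dd \<phi> u"]) auto
    moreover have "(\<lambda>N. - (k u * norm (S N)) - \<delta>) \<longlonglongrightarrow> - (k u * norm (V u)) - \<delta>"
      by (intro tendsto_intros S)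
    ultimately have "clarke_dd \<phi> u (V u) \<le> - (k u * norm (V u)) - \<delta>"
      using SN by (intro LIMSEQ_le) (auto intro!: exI[of _ "Suc n0"])
    then show ?thesis using \<delta> by simp
  qed
  ultimately show thesis using that by blast
qed

section \<open>Step sizes and iterated Euler steps\<close>

lemma continuous_step_size:
  fixes W :: "'a::metric_space set" and P :: "'a \<Rightarrow> real \<Rightarrow> bool"
  assumes mono: "\<And>u r r'. P u r \<Longrightarrow> 0 \<le> r' \<Longrightarrow> r' \<le> r \<Longrightarrow> P u r'"
    and loc: "\<And>u. u \<in> W \<Longrightarrow> \<exists>d>0. \<forall>w\<in>W \<inter> ball u d. P w d"
  obtains \<tau> :: "'a \<Rightarrow> real" where "continuous_on UNIV \<tau>" "\<And>u. u \<in> W \<Longrightarrow> \<tau> u > 0" "\<And>u. u \<in> W \<Longrightarrow> P u (\<tau> u)"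
proof -
  \<comment> \<open>Asking for \<open>P w d\<close> on a whole ball makes \<open>Sup (T u)\<close>
    1-Lipschitz: moving the centre costs at most the distance moved. The cap 1 keeps the supremum
    finite.\<close>
  define T where "T u = {d. 0 \<le> d \<and> d \<le> 1 \<and> (\<forall>w\<in>W \<inter> ball u d. P w d)}" for u
  have T0: "0 \<in> T u" for u by (auto simp: T_def)
  have bd: "bdd_above (T u)" for u by (intro bdd_aboveI[of _ 1]) (auto simp: T_def)
  have diff: "Sup (T u) \<le> Sup (T u') + dist u u'" for u u'
  proof (rule cSup_least)
    fix d assume d: "d \<in> T u"
    show "d \<le> Sup (T u') + dist u u'"
    proof (cases "d \<le> dist u u'")
      case True
      then show ?thesis using cSup_upper[OF T0 bd, of u'] by simp
    next
      case False
      have "P w (d - dist u u')" if "w \<in> W \<inter> ball u' (d - dist u u')" for w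
      proof (rule mono[of _ d])
        have "w \<in> W \<inter> ball u d" using that dist_triangle[of u w u'] by auto
        then show "P w d" using d by (auto simp: T_def)
      qed (use False in auto)
      then have "d - dist u u' \<in> T u'"
        using d False zero_le_dist[of u u'] by (auto simp: T_def simp del: zero_le_dist)
      then show ?thesis using cSup_upper[OF _ bd] by fastforce
    qed
  qed (use T0 in blast)
  have "1-lipschitz_on UNIV (\<lambda>u. Sup (T u))"
  proof (rule lipschitz_onI)
    show "dist (Sup (T u)) (Sup (T u')) \<le> 1 * dist u u'" for u u'
      using diff[of u u'] diff[of u' u] by (simp add: dist_real_def abs_le_iff dist_commute)
  qed simp
  then have cont: "continuous_on UNIV (\<lambda>u. Sup (T u))"
    by (rule lipschitz_on_continuous_on)
  have pos: "Sup (T u) > 0" if u: "u \<in> W" for u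
  proof -
    obtain d where d: "d > 0" "\<forall>w\<in>W \<inter> ball u d. P w d" using loc[OF u] by blast
    have "min d 1 \<in> T u"
      using d by (auto simp: T_def intro: mono[of _ d])
    then have "min d 1 \<le> Sup (T u)" using bd by (rule cSup_upper)
    then show ?thesis using d(1) by linarith
  qed
  show thesis
  proof (rule that[of "\<lambda>u. Sup (T u) / 2"])
    show "continuous_on UNIV (\<lambda>u. Sup (T u) / 2)" by (intro continuous_intros cont) auto
  next
    fix u assume u: "u \<in> W"
    show "Sup (T u) / 2 > 0" using pos[OF u] by simp
    \<comment> \<open>Half of the supremum lies below an element of \<open>T u\<close>, whether or
      not the supremum is attained.\<close>
    have "Sup (T u) / 2 < Sup (T u)" using pos[OF u] by simp
    then obtain d where d: "d \<in> T u" "Sup (T u) / 2 < d"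
      using less_cSup_iff[OF _ bd] T0 by blast
    have "d > 0" using d(2) pos[OF u] by simp
    then have "P u d" using d(1) u by (auto simp: T_def)
    then show "P u (Sup (T u) / 2)" by (rule mono) (use d(2) pos[OF u] in auto)
  qed
qed

text \<open>\<open>A\<close> stands for the open condition of staying above level \<open>a\<close>,
  \<open>down\<close> for the absence of critical levels. The estimate compares any two points of
  the segment, with the rate taken at the earlier one, because crossings of annuli may begin and end
  in the middle of an edge.\<close>

lemma descent_step:
  fixes \<phi> :: "'a::banach \<Rightarrow> real"
  assumes lip: "locally_lipschitz \<phi>" and kcont: "continuous_on UNIV k"
    and kpos: "\<And>u. u \<in> W \<Longrightarrow> 0 < k u"
    and desc: "\<And>u. u \<in> W \<Longrightarrow> \<exists>v. norm v \<le> 1 \<and> clarke_dd \<phi> u v < - k u"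
    and A: "open A" "W \<subseteq> A"
    and down: "\<And>u w. u \<in> W \<Longrightarrow> w \<in> A \<Longrightarrow> \<phi> w < \<phi> u \<Longrightarrow> w \<in> W"
  obtains S :: "real \<Rightarrow> 'a \<Rightarrow> 'a" where
    "continuous_on ({0..1} \<times> W) (\<lambda>(r, u). S r u)"
    "\<And>u. S 0 u = u"
    "\<And>r u. r \<in> {0..1} \<Longrightarrow> u \<in> W \<Longrightarrow> S r u \<in> W"
    "\<And>u. u \<in> W \<Longrightarrow> \<phi> (S 1 u) < \<phi> u"
    "\<And>r s u. u \<in> W \<Longrightarrow> 0 \<le> r \<Longrightarrow> r \<le> s \<Longrightarrow> s \<le> 1 \<Longrightarrow>
       k (S r u) * dist (S r u) (S s u) \<le> \<phi> (S r u) - \<phi> (S s u)"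
proof -
  obtain V where V: "continuous_on UNIV V"
    "\<And>u. u \<in> W \<Longrightarrow> clarke_dd \<phi> u (V u) < - (k u * norm (V u))"
    using continuous_descent_field[OF lip kcont _ desc, of W] kpos less_imp_le by metis
  have V0: "V u \<noteq> 0" if "u \<in> W" for u
    using V(2)[OF that] sublinear_zero[OF sublinear_clarke_dd[OF lip]] by auto
  define P where "P u r \<longleftrightarrow> (\<forall>s t. 0 \<le> s \<longrightarrow> s \<le> t \<longrightarrow> t \<le> r \<longrightarrow> u + t *\<^sub>R V u \<in> A \<and>
      k (u + s *\<^sub>R V u) * ((t - s) * norm (V u)) \<le> \<phi> (u + s *\<^sub>R V u) - \<phi> (u + t *\<^sub>R V u))" for u r
  have "\<exists>d>0. \<forall>w\<in>W \<inter> ball u d. P w d" if u: "u \<in> W" for u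
  proof -
    \<comment> \<open>\<kappa> is the midpoint of \<open>k u * norm (V u)\<close> and
      \<open>- clarke_dd \<phi> u (V u)\<close>, so both comparisons are strict and survive a small
      change of the base point.\<close>
    define \<kappa> where "\<kappa> = (k u * norm (V u) - clarke_dd \<phi> u (V u)) / 2"
    have \<kappa>: "clarke_dd \<phi> u (V u) < - \<kappa>" "k u * norm (V u) < \<kappa>"
      using V(2)[OF u] unfolding \<kappa>_def by (simp_all only: field_simps)
    obtain r where r: "r > 0" "\<And>w v' t. w \<in> ball u r \<Longrightarrow> v' \<in> ball (V u) r \<Longrightarrow> t \<in> {0<..<r} \<Longrightarrow>
        \<phi> (w + t *\<^sub>R v') - \<phi> w < - \<kappa> * t"
      using clarke_dd_less_direction[OF lip \<kappa>(1)] by metis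
    \<comment> \<open>All these conditions on the pair \<open>(w, s)\<close> are open and hold at
      \<open>(u, 0)\<close>, which gives one radius for base point and time together.\<close>
    define Q where "Q = {(w, s). w + s *\<^sub>R V w \<in> ball u r \<inter> A \<and> V w \<in> ball (V u) r \<and>
        k (w + s *\<^sub>R V w) * norm (V w) < \<kappa>}"
    have cV: "continuous_on UNIV (\<lambda>x::'a\<times>real. V (fst x))"
      by (intro continuous_on_compose2[OF V(1)] continuous_intros) auto
    have cs: "continuous_on UNIV (\<lambda>x::'a\<times>real. fst x + snd x *\<^sub>R V (fst x))"
      by (intro continuous_intros cV)
    have ck: "continuous_on UNIV (\<lambda>x::'a\<times>real. k (fst x + snd x *\<^sub>R V (fst x)))"
      by (intro continuous_on_compose2[OF kcont cs]) auto
    have "Q = (\<lambda>x. fst x + snd x *\<^sub>R V (fst x)) -` (ball u r \<inter> A) \<inter>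
        (\<lambda>x. V (fst x)) -` ball (V u) r \<inter> {x. k (fst x + snd x *\<^sub>R V (fst x)) * norm (V (fst x)) < \<kappa>}"
      by (auto simp: Q_def)
    moreover have "open \<dots>"
      by (intro open_Int open_vimage cs cV open_ball A(1) open_Collect_less continuous_intros ck)
    ultimately have "open Q" by simp
    moreover have "(u, 0) \<in> Q" using r(1) \<kappa>(2) u A(2) by (auto simp: Q_def)
    ultimately obtain d where d: "d > 0" "ball (u, 0) d \<subseteq> Q"
      using open_contains_ball by blast
    define d' where "d' = min (d/2) (r/2)"
    have d': "d' > 0" "d' \<le> d/2" "d' < r" using d(1) r(1) by (auto simp: d'_def)
    have "P w d'" if w: "w \<in> W \<inter> ball u d'" for w
      unfolding P_def
    proof (intro allI impI)
      fix s t assume st: "0 \<le> s" "s \<le> t" "t \<le> d'"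
      have inQ: "(w, x) \<in> Q" if "0 \<le> x" "x \<le> d'" for x
      proof -
        have "dist (u, 0) (w, x) \<le> dist u w + dist 0 x"
          unfolding dist_Pair_Pair by (rule sqrt_sum_squares_le_sum) auto
        then have "dist (u, 0) (w, x) < d" using w that d'(2) by auto
        then show ?thesis using d(2) by auto
      qed
      have s: "(w, s) \<in> Q" and t: "(w, t) \<in> Q" using st by (auto intro: inQ)
      have "k (w + s *\<^sub>R V w) * ((t - s) * norm (V w)) \<le> \<phi> (w + s *\<^sub>R V w) - \<phi> (w + t *\<^sub>R V w)"
      proof (cases "s = t")
        case False
        have "\<phi> ((w + s *\<^sub>R V w) + (t - s) *\<^sub>R V w) - \<phi> (w + s *\<^sub>R V w) < - \<kappa> * (t - s)"
          using s st False d'(3) by (intro r(2)) (auto simp: Q_def)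
        moreover have "k (w + s *\<^sub>R V w) * norm (V w) * (t - s) \<le> \<kappa> * (t - s)"
          using s st by (intro mult_right_mono) (auto simp: Q_def)
        ultimately show ?thesis by (simp add: algebra_simps)
      qed simp
      then show "w + t *\<^sub>R V w \<in> A \<and>
        k (w + s *\<^sub>R V w) * ((t - s) * norm (V w)) \<le> \<phi> (w + s *\<^sub>R V w) - \<phi> (w + t *\<^sub>R V w)"
        using t by (auto simp: Q_def)
    qed
    then show ?thesis using d'(1) by blast
  qed
  moreover have "P u r'" if "P u r" "0 \<le> r'" "r' \<le> r" for u r r'
    using that unfolding P_def by auto
  ultimately obtain \<tau> where \<tau>: "continuous_on UNIV \<tau>" "\<And>u. u \<in> W \<Longrightarrow> \<tau> u > 0" "\<And>u. u \<in> W \<Longrightarrow> P u (\<tau> u)"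
    using continuous_step_size[of P W] by metis
  define S where "S r u = u + (r * \<tau> u) *\<^sub>R V u" for r u
  have est: "S s u \<in> A \<and> k (S r u) * dist (S r u) (S s u) \<le> \<phi> (S r u) - \<phi> (S s u)"
    if u: "u \<in> W" and "0 \<le> r" "r \<le> s" "s \<le> 1" for r s u
  proof -
    have "dist (S r u) (S s u) = norm ((r * \<tau> u - s * \<tau> u) *\<^sub>R V u)"
      by (simp add: S_def dist_norm scaleR_diff_left)
    also have "\<dots> = (s * \<tau> u - r * \<tau> u) * norm (V u)"
      using that \<tau>(2)[OF u] by (simp add: abs_if mult_less_cancel_right)
    finally have eq: "dist (S r u) (S s u) = (s * \<tau> u - r * \<tau> u) * norm (V u)" .
    have *: "0 \<le> r * \<tau> u" "r * \<tau> u \<le> s * \<tau> u" "s * \<tau> u \<le> \<tau> u"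
      using that \<tau>(2)[OF u] by (auto intro: mult_right_mono)
    show ?thesis
      using \<tau>(3)[OF u] * unfolding P_def eq by (simp add: S_def)
  qed
  have strict: "\<phi> (S r u) < \<phi> u" if u: "u \<in> W" and "0 < r" "r \<le> 1" for r u
  proof -
    have "S r u \<noteq> u" using V0[OF u] \<tau>(2)[OF u] that by (simp add: S_def)
    then have "0 < k u * dist u (S r u)" using kpos[OF u] by (simp add: dist_commute)
    also have "\<dots> \<le> \<phi> u - \<phi> (S r u)" using est[OF u, of 0 r] that by (simp add: S_def)
    finally show ?thesis by simp
  qed
  have cVW: "continuous_on X (\<lambda>x::real\<times>'a. V (snd x))" and ctW: "continuous_on X (\<lambda>x::real\<times>'a. \<tau> (snd x))" for X
    by (intro continuous_on_compose2[OF V(1)] continuous_on_compose2[OF \<tau>(1)] continuous_intros; simp)+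
  show thesis
  proof (rule that[of S])
    show "continuous_on ({0..1} \<times> W) (\<lambda>(r, u). S r u)"
      unfolding S_def case_prod_unfold by (intro continuous_intros cVW ctW)
    show "S r u \<in> W" if "r \<in> {0..1}" "u \<in> W" for r u
    proof (cases "r = 0")
      case True
      then show ?thesis using that by (simp add: S_def)
    next
      case False
      then have "S r u \<in> A" "\<phi> (S r u) < \<phi> u" using that est[of u r r] strict[of u r] by simp_all
      then show ?thesis by (rule down[OF that(2)])
    qed
    show "\<phi> (S 1 u) < \<phi> u" if "u \<in> W" for u
      using strict[OF that] by simp
    show "k (S r u) * dist (S r u) (S s u) \<le> \<phi> (S r u) - \<phi> (S s u)"
      if "u \<in> W" "0 \<le> r" "r \<le> s" "s \<le> 1" for r s u
      using est[OF that] by simp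
  qed (simp add: S_def)
qed

text \<open>\<open>B n s\<close> performs \<open>n\<close> stages, stage \<open>i\<close> (counted
  from 0) for the time \<open>clip (s - i)\<close>. Each \<open>B n\<close> is continuous without
  gluing at the integers: stages not yet begun are the identity, finished ones have run for time
  1.\<close>

lemma iterate_homotopy:
  fixes S :: "real \<Rightarrow> 'a::topological_space \<Rightarrow> 'a"
  assumes cont: "continuous_on ({0..1} \<times> W) (\<lambda>(r, u). S r u)"
    and S0: "\<And>u. S 0 u = u" and SW: "\<And>r u. r \<in> {0..1} \<Longrightarrow> u \<in> W \<Longrightarrow> S r u \<in> W"
  obtains \<sigma> :: "real \<Rightarrow> 'a \<Rightarrow> 'a" where
    "continuous_on ({0..} \<times> W) (\<lambda>(s, u). \<sigma> s u)" "\<And>u. \<sigma> 0 u = u"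
    "\<And>s u. s \<ge> 0 \<Longrightarrow> u \<in> W \<Longrightarrow> \<sigma> s u \<in> W"
    "\<And>n r u. r \<in> {0..1} \<Longrightarrow> \<sigma> (real n + r) u = S r (\<sigma> (real n) u)"
proof -
  define clip where "clip x = max 0 (min 1 x)" for x :: real
  have clip: "clip x \<in> {0..1}" for x by (auto simp: clip_def)
  define B where "B n s u = rec_nat u (\<lambda>n x. S (clip (s - real n)) x) n" for n s u
  have B0: "B 0 s u = u" and BSuc: "B (Suc n) s u = S (clip (s - real n)) (B n s u)" for n s u
    by (simp_all add: B_def)
  have BW: "B n s u \<in> W" if "u \<in> W" for n s u
    by (induction n) (simp_all only: B0 BSuc that SW[OF clip])
  have Bcont: "continuous_on (UNIV \<times> W) (\<lambda>x. B n (fst x) (snd x))" for n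
  proof (induction n)
    case (Suc n)
    have "continuous_on (UNIV \<times> W) (\<lambda>x. clip (fst x - real n))"
      unfolding clip_def by (intro continuous_intros)
    then have "continuous_on (UNIV \<times> W) (\<lambda>x. (clip (fst x - real n), B n (fst x) (snd x)))"
      using Suc by (intro continuous_intros)
    then show ?case
      unfolding BSuc
      by (rule continuous_on_compose2[OF cont, where f = "\<lambda>x. (_ x, _ x)", unfolded prod.case])
         (use BW clip in \<open>auto simp del: atLeastAtMost_iff\<close>)
  qed (simp add: B0 continuous_on_snd continuous_on_id)
  have Bstat: "B (n + m) s u = B n s u" if "s \<le> real n" for n m s u
  proof (induction m)
    case (Suc m)
    have "clip (s - real (n + m)) = 0" using that by (simp add: clip_def)
    then show ?case using Suc by (simp add: BSuc S0)
  qed simp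
  have Beq: "B n s u = B n s' u" if "s \<ge> real n" "s' \<ge> real n" for n s s' u
    using that
  proof (induction n)
    case (Suc n)
    have "clip (s - real n) = 1" "clip (s' - real n) = 1" using Suc.prems by (auto simp: clip_def)
    then show ?case using Suc by (simp add: BSuc)
  qed (simp add: B0)
  define \<sigma> where "\<sigma> s u = B (nat \<lceil>s\<rceil>) s u" for s u
  have \<sigma>B: "\<sigma> s u = B n s u" if "s \<le> real n" for s u n
  proof -
    have "nat \<lceil>s\<rceil> \<le> n" using that by (simp add: nat_le_iff ceiling_le_iff)
    then obtain m where "n = nat \<lceil>s\<rceil> + m" using le_Suc_ex by blast
    moreover have "s \<le> real (nat \<lceil>s\<rceil>)" by linarith
    ultimately show ?thesis using Bstat by (simp add: \<sigma>_def)
  qed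
  show thesis
  proof (rule that[of \<sigma>])
    show "\<sigma> 0 u = u" for u by (simp add: \<sigma>_def B0)
    show "\<sigma> s u \<in> W" if "u \<in> W" for s u using BW that by (simp add: \<sigma>_def)
    show "\<sigma> (real n + r) u = S r (\<sigma> (real n) u)" if "r \<in> {0..1}" for n r u
    proof -
      have "\<sigma> (real n + r) u = B (Suc n) (real n + r) u" using that by (intro \<sigma>B) simp
      also have "\<dots> = S r (B n (real n + r) u)" using that by (simp add: BSuc clip_def)
      also have "B n (real n + r) u = \<sigma> (real n) u"
        using that Beq[of n "real n + r" "real n" u] \<sigma>B[of "real n" n u] by simp
      finally show ?thesis .
    qed
    show "continuous_on ({0..} \<times> W) (\<lambda>(s, u). \<sigma> s u)"
      unfolding continuous_on_def
    proof
      fix x assume x: "x \<in> {0::real..} \<times> W"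
      \<comment> \<open>Continuity is local in time, and for times below \<open>N\<close> the number
        of stages can be fixed at \<open>N\<close>.\<close>
      obtain N where N: "fst x < real N" using reals_Archimedean2 by blast
      have "continuous_on ({0..<real N} \<times> W) (\<lambda>x. B N (fst x) (snd x))"
        by (rule continuous_on_subset[OF Bcont]) auto
      then have "continuous_on ({0..<real N} \<times> W) (\<lambda>(s, u). \<sigma> s u)"
        by (rule continuous_on_eq) (clarsimp simp: \<sigma>B[OF less_imp_le])
      moreover have "at x within {0..} \<times> W = at x within {0..<real N} \<times> W"
        by (rule at_within_nhd[of _ "{..<real N} \<times> UNIV"]) (use N in \<open>auto simp: open_Times mem_Times_iff\<close>)
      moreover have "x \<in> {0..<real N} \<times> W" using x N by (auto simp: mem_Times_iff)
      ultimately show "((\<lambda>(s, u). \<sigma> s u) \<longlongrightarrow> (case x of (s, u) \<Rightarrow> \<sigma> s u)) (at x within {0..} \<times> W)"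
        unfolding continuous_on_def by metis
    qed
  qed
qed

section \<open>A continuous minorant of the Cerami weight\<close>

text \<open>The weight \<open>(1 + norm u) * mnorm \<phi> u\<close> is only lower semicontinuous. The term
  \<open>\<bar>\<phi> y - \<phi> u\<bar>\<close> keeps near-minimisers \<open>y\<close> at bounded levels, so that the Cerami
  condition survives the regularisation.\<close>

definition cerami_slope :: "('a::real_normed_vector \<Rightarrow> real) \<Rightarrow> 'a \<Rightarrow> real" where
  "cerami_slope \<phi> u = (INF y. (1 + norm y) * mnorm \<phi> y + dist y u + \<bar>\<phi> y - \<phi> u\<bar>)"

context
  fixes \<phi> :: "'a::real_normed_vector \<Rightarrow> real"
  assumes lip: "locally_lipschitz \<phi>"
begin

lemma cerami_weight_nonneg: "0 \<le> (1 + norm y) * mnorm \<phi> y"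
  using mnorm_nonneg[OF lip] by (simp add: add_nonneg_nonneg)

lemma bdd_below_cerami_slope:
  "bdd_below (range (\<lambda>y. (1 + norm y) * mnorm \<phi> y + dist y u + \<bar>\<phi> y - \<phi> u\<bar>))"
  by (rule bdd_belowI2[of _ 0]) (simp add: cerami_weight_nonneg add_nonneg_nonneg)

lemma cerami_slope_le: "cerami_slope \<phi> u \<le> (1 + norm y) * mnorm \<phi> y + dist y u + \<bar>\<phi> y - \<phi> u\<bar>"
  unfolding cerami_slope_def by (rule cINF_lower[OF bdd_below_cerami_slope]) simp

lemma cerami_slope_nonneg: "0 \<le> cerami_slope \<phi> u"
  unfolding cerami_slope_def
  by (rule cINF_greatest) (simp_all add: cerami_weight_nonneg add_nonneg_nonneg)

text \<open>When \<open>u\<close> is replaced by \<open>w\<close>, every function in the infimum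
  changes by at most \<open>dist u w + \<bar>\<phi> u - \<phi> w\<bar>\<close>, hence so does the
  infimum.\<close>

lemma continuous_on_cerami_slope: "continuous_on UNIV (cerami_slope \<phi>)"
proof -
  have le: "cerami_slope \<phi> u - (dist u w + \<bar>\<phi> u - \<phi> w\<bar>) \<le> cerami_slope \<phi> w" for u w
    unfolding cerami_slope_def[of \<phi> w]
  proof (rule cINF_greatest)
    fix y
    show "cerami_slope \<phi> u - (dist u w + \<bar>\<phi> u - \<phi> w\<bar>) \<le>
        (1 + norm y) * mnorm \<phi> y + dist y w + \<bar>\<phi> y - \<phi> w\<bar>"
      using cerami_slope_le[of u y] dist_triangle[of y u w] by (simp add: dist_commute)
  qed simp
  have "(cerami_slope \<phi> \<longlongrightarrow> cerami_slope \<phi> u) (at u)" for u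
  proof (rule Lim_null[THEN iffD2], rule Lim_null_comparison)
    show "eventually (\<lambda>w. norm (cerami_slope \<phi> w - cerami_slope \<phi> u) \<le> dist w u + \<bar>\<phi> w - \<phi> u\<bar>) (at u)"
      using le[of u] le[of _ u] by (auto intro!: always_eventually simp: abs_le_iff dist_commute abs_minus_commute algebra_simps)
    have "(\<phi> \<longlongrightarrow> \<phi> u) (at u)"
      using locally_lipschitz_continuous_on[OF lip, of UNIV] by (simp add: continuous_on_def)
    then have "((\<lambda>w. dist w u + \<bar>\<phi> w - \<phi> u\<bar>) \<longlongrightarrow> dist u u + \<bar>\<phi> u - \<phi> u\<bar>) (at u)"
      by (intro tendsto_intros)
    then show "((\<lambda>w. dist w u + \<bar>\<phi> w - \<phi> u\<bar>) \<longlongrightarrow> 0) (at u)" by simp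
  qed
  then show ?thesis by (simp add: continuous_on_def)
qed

text \<open>Near-minimisers \<open>y n\<close> of the infimum are close to \<open>w n\<close> in
  distance and in level and have small Cerami weight. The Cerami condition applies to them, and the
  limit of a subsequence carries over to \<open>w\<close>.\<close>

lemma cerami_slope_compactness:
  assumes cer: "cerami \<phi>" and lim: "(\<lambda>n. cerami_slope \<phi> (w n)) \<longlonglongrightarrow> 0"
    and bd: "bounded (range (\<lambda>n. \<phi> (w n)))"
  obtains r y where "strict_mono (r :: nat \<Rightarrow> nat)" "(\<lambda>n. w (r n)) \<longlonglongrightarrow> y" "y \<in> crit \<phi>"
proof -
  define G where "G n y = (1 + norm y) * mnorm \<phi> y + dist y (w n) + \<bar>\<phi> y - \<phi> (w n)\<bar>" for n y
  have "\<exists>y. G n y < cerami_slope \<phi> (w n) + inverse (real (Suc n))" for n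
  proof -
    have "(INF y. G n y) < cerami_slope \<phi> (w n) + inverse (real (Suc n))"
      by (simp add: G_def cerami_slope_def)
    then show ?thesis
      using cINF_less_iff[OF _ bdd_below_cerami_slope[of "w n"]] by (simp add: G_def)
  qed
  then obtain y where y: "\<And>n. G n (y n) < cerami_slope \<phi> (w n) + inverse (real (Suc n))"
    by metis
  have "(\<lambda>n. cerami_slope \<phi> (w n) + inverse (real (Suc n))) \<longlonglongrightarrow> 0 + 0"
    by (intro tendsto_add lim LIMSEQ_inverse_real_of_nat)
  then have G0: "(\<lambda>n. cerami_slope \<phi> (w n) + inverse (real (Suc n))) \<longlonglongrightarrow> 0" by simp
  have null: "f \<longlonglongrightarrow> 0" if "\<And>n. 0 \<le> f n" "\<And>n. f n \<le> G n (y n)" for f :: "nat \<Rightarrow> real"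
  proof (rule tendsto_sandwich[OF _ _ tendsto_const G0])
    show "eventually (\<lambda>n. f n \<le> cerami_slope \<phi> (w n) + inverse (real (Suc n))) sequentially"
      using that(2) y by (intro always_eventually allI) (meson less_imp_le order_trans)
  qed (use that(1) in simp)
  have weight: "(\<lambda>n. (1 + norm (y n)) * mnorm \<phi> (y n)) \<longlonglongrightarrow> 0"
    by (rule null) (auto simp: G_def cerami_weight_nonneg)
  have dist0: "(\<lambda>n. dist (y n) (w n)) \<longlonglongrightarrow> 0"
    by (rule null) (auto simp: G_def intro!: add_increasing cerami_weight_nonneg)
  have diff0: "(\<lambda>n. \<bar>\<phi> (y n) - \<phi> (w n)\<bar>) \<longlonglongrightarrow> 0"
    by (rule null) (auto simp: G_def intro!: add_nonneg_nonneg cerami_weight_nonneg)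
  have "bounded (range (\<lambda>n. \<phi> (y n)))"
  proof -
    have "bounded (range (\<lambda>n. \<bar>\<phi> (y n) - \<phi> (w n)\<bar>))"
      using diff0 by (rule convergent_imp_bounded)
    then obtain B1 where B1: "\<And>n. norm \<bar>\<phi> (y n) - \<phi> (w n)\<bar> \<le> B1"
      unfolding bounded_iff by blast
    obtain B2 where B2: "\<And>n. norm (\<phi> (w n)) \<le> B2" using bd unfolding bounded_iff by blast
    have "norm (\<phi> (y n)) \<le> B1 + B2" for n using B1[of n] B2[of n] by simp
    then show ?thesis unfolding bounded_iff by blast
  qed
  then obtain r where r: "strict_mono (r :: nat \<Rightarrow> nat)" "convergent (y \<circ> r)"
    using cer weight unfolding cerami_def by blast
  then obtain z where z: "(\<lambda>n. y (r n)) \<longlonglongrightarrow> z" unfolding convergent_def o_def by blast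
  have sub: "(\<lambda>n. f (r n)) \<longlonglongrightarrow> l" if "f \<longlonglongrightarrow> l" for f :: "nat \<Rightarrow> real" and l
    using LIMSEQ_subseq_LIMSEQ[OF that r(1)] by (simp add: o_def)
  have "(\<lambda>n. mnorm \<phi> (y (r n))) \<longlonglongrightarrow> 0"
  proof (rule tendsto_sandwich[OF _ _ tendsto_const sub[OF weight]])
    show "eventually (\<lambda>n. mnorm \<phi> (y (r n)) \<le> (1 + norm (y (r n))) * mnorm \<phi> (y (r n))) sequentially"
      using mnorm_nonneg[OF lip] by (intro always_eventually) (simp add: algebra_simps)
  qed (use mnorm_nonneg[OF lip] in auto)
  then have "z \<in> crit \<phi>" by (rule crit_of_mnorm_tendsto_0[OF lip z])
  moreover have "(\<lambda>n. w (r n)) \<longlonglongrightarrow> z"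
    using z
  proof (rule Lim_transform)
    show "(\<lambda>n. w (r n) - y (r n)) \<longlonglongrightarrow> 0"
      using sub[OF dist0] unfolding dist_norm norm_minus_commute[of "y _"] by (rule tendsto_norm_zero_cancel)
  qed
  ultimately show thesis using that r(1) by blast
qed

lemma cerami_slope_pos:
  assumes "cerami \<phi>" "u \<notin> crit \<phi>"
  shows "0 < cerami_slope \<phi> u"
proof (rule ccontr)
  assume "\<not> 0 < cerami_slope \<phi> u"
  then have "cerami_slope \<phi> u = 0" using cerami_slope_nonneg[of u] by simp
  then obtain r y where "(\<lambda>n::nat. u) \<longlonglongrightarrow> y" "y \<in> crit \<phi>"
    using cerami_slope_compactness[OF assms(1), of "\<lambda>_. u"] by auto
  then show False using assms(2) LIMSEQ_unique[OF tendsto_const] by metis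
qed

end

section \<open>The descending flow\<close>

text \<open>Take for \<open>t\<close> the first time at height at least \<open>q\<close> and for
  \<open>s\<close> the last time before \<open>t\<close> at height at most \<open>p\<close>; in
  between nothing can leave \<open>[p, q]\<close>.\<close>

lemma annulus_crossing:
  fixes f :: "real \<Rightarrow> real"
  assumes cont: "continuous_on {s0..T} f" and "s0 \<le> T" "f s0 \<le> p" "p \<le> q" "q \<le> f T"
  obtains s t where "s0 \<le> s" "s \<le> t" "t \<le> T" "f s = p" "f t = q" "\<And>r. r \<in> {s..t} \<Longrightarrow> p \<le> f r \<and> f r \<le> q"
proof -
  have "compact ({s0..T} \<inter> {r \<in> {s0..T}. q \<le> f r})"
    using cont by (intro compact_Int_closed compact_Icc continuous_on_closed_Collect_le continuous_on_const closed_atLeastAtMost)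
  moreover have "T \<in> {s0..T} \<inter> {r \<in> {s0..T}. q \<le> f r}" using assms by auto
  ultimately obtain t where t: "t \<in> {s0..T}" "q \<le> f t"
    "\<And>r. r \<in> {s0..T} \<Longrightarrow> q \<le> f r \<Longrightarrow> t \<le> r"
    using compact_attains_inf[of "{s0..T} \<inter> {r \<in> {s0..T}. q \<le> f r}"] by blast
  have cont_t: "continuous_on {s0..t} f" using t(1) by (intro continuous_on_subset[OF cont]) auto
  obtain t' where "s0 \<le> t'" "t' \<le> t" "f t' = q"
    using IVT'[of f s0 q t] t(1,2) assms cont_t by auto
  then have ft: "f t = q" using t(1) t(3)[of t'] by force
  have "compact ({s0..t} \<inter> {r \<in> {s0..t}. f r \<le> p})"
    using cont_t by (intro compact_Int_closed compact_Icc continuous_on_closed_Collect_le continuous_on_const closed_atLeastAtMost)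
  moreover have "s0 \<in> {s0..t} \<inter> {r \<in> {s0..t}. f r \<le> p}" using assms t(1) by auto
  ultimately obtain s where s: "s \<in> {s0..t}" "f s \<le> p"
    "\<And>r. r \<in> {s0..t} \<Longrightarrow> f r \<le> p \<Longrightarrow> r \<le> s"
    using compact_attains_sup[of "{s0..t} \<inter> {r \<in> {s0..t}. f r \<le> p}"] by blast
  have "continuous_on {s..t} f" using s(1) by (intro continuous_on_subset[OF cont_t]) auto
  then obtain s' where "s \<le> s'" "s' \<le> t" "f s' = p"
    using IVT'[of f s p t] s(1,2) assms ft by auto
  then have fs: "f s = p" using s(1) s(3)[of s'] by force
  have "p \<le> f r \<and> f r \<le> q" if "r \<in> {s..t}" for r
    using s(3)[of r] t(3)[of r] that s(1) t(1) fs ft by force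
  then show thesis using s(1) t(1) fs ft by (intro that[of s t]) auto
qed

text \<open>Passes from edges to polygons. It is applied to implications whose premise quantifies
  over the time interval and therefore restricts to subintervals.\<close>

lemma unit_interval_chain:
  fixes Q :: "real \<Rightarrow> real \<Rightarrow> bool"
  assumes trans: "\<And>r s t. r \<le> s \<Longrightarrow> s \<le> t \<Longrightarrow> Q r s \<Longrightarrow> Q s t \<Longrightarrow> Q r t"
    and seg: "\<And>n r s. 0 \<le> r \<Longrightarrow> r \<le> s \<Longrightarrow> s \<le> 1 \<Longrightarrow> Q (real n + r) (real n + s)"
    and "0 \<le> s" "s \<le> t"
  shows "Q s t"
proof -
  define n where "n = nat \<lfloor>s\<rfloor>"
  have n: "real n \<le> s" "s \<le> real n + 1" using assms(3) unfolding n_def by linarith+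
  have seg': "Q r t" if "real i \<le> r" "r \<le> t" "t \<le> real i + 1" for i r t
    using seg[of "r - real i" "t - real i" i] that by simp
  have "Q s t" if "s \<le> t" "t \<le> real (n + m) + 1" for m t
    using that
  proof (induction m arbitrary: t)
    case 0
    then show ?case using seg'[of n s t] n by simp
  next
    case (Suc m)
    show ?case
    proof (cases "t \<le> real (n + m) + 1")
      case False
      have "Q s (real (n + m) + 1)" using n by (intro Suc.IH) auto
      moreover have "Q (real (n + m) + 1) t"
        using seg'[of "Suc (n + m)" "real (n + m) + 1" t] False Suc.prems by simp
      ultimately show ?thesis
        using n False by (intro trans[of s "real (n + m) + 1" t]) auto
    qed (use Suc in auto)
  qed
  moreover obtain m where "t \<le> real m" using real_arch_simple by blast
  then have "t \<le> real (n + m) + 1" by simp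
  ultimately show ?thesis using assms(4) by blast
qed

text \<open>The flow \<open>\<sigma>\<close> is not a semigroup: \<open>\<sigma> s u\<close> is a polygon in \<open>s\<close> with vertices at the
  integers, and the descent estimate holds on each of its edges.\<close>

locale cerami_descent =
  fixes \<phi> :: "'a::banach \<Rightarrow> real" and a :: real and b :: ereal
    and W :: "'a set" and \<sigma> :: "real \<Rightarrow> 'a \<Rightarrow> 'a"
  assumes lip: "locally_lipschitz \<phi>" and cer: "cerami \<phi>"
    and fin: "finite (crit_at \<phi> (ereal a))"
    and nocrit: "\<And>c::real. a < c \<Longrightarrow> ereal c < b \<Longrightarrow> crit_at \<phi> (ereal c) = {}"
    and W_def: "W = {u. a < \<phi> u \<and> ereal (\<phi> u) \<le> b \<and> u \<notin> crit \<phi>}"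
    and cont: "continuous_on ({0..} \<times> W) (\<lambda>(s, u). \<sigma> s u)"
    and start: "\<And>u. \<sigma> 0 u = u"
    and stays: "\<And>s u. 0 \<le> s \<Longrightarrow> u \<in> W \<Longrightarrow> \<sigma> s u \<in> W"
    and edge: "\<And>n r s u. u \<in> W \<Longrightarrow> 0 \<le> r \<Longrightarrow> r \<le> s \<Longrightarrow> s \<le> 1 \<Longrightarrow>
      cerami_slope \<phi> (\<sigma> (real n + r) u) / (2 * (1 + norm (\<sigma> (real n + r) u)))
        * dist (\<sigma> (real n + r) u) (\<sigma> (real n + s) u)
      \<le> \<phi> (\<sigma> (real n + r) u) - \<phi> (\<sigma> (real n + s) u)"
    and strict: "\<And>u. u \<in> W \<Longrightarrow> \<phi> (\<sigma> 1 u) < \<phi> u"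
    and no_stall: "\<And>u z. u \<in> W \<Longrightarrow> (\<lambda>n. \<sigma> (real n) u) \<longlonglongrightarrow> z \<Longrightarrow> z \<notin> W"
begin

section \<open>The cost of moving along a polygon\<close>

definition rate :: "'a \<Rightarrow> real" where
  "rate u = cerami_slope \<phi> u / (2 * (1 + norm u))"

lemma rate_nonneg: "0 \<le> rate u"
  unfolding rate_def using cerami_slope_nonneg[OF lip] by (simp add: add_nonneg_nonneg)

lemma level_gt: "0 \<le> s \<Longrightarrow> u \<in> W \<Longrightarrow> a < \<phi> (\<sigma> s u)"
  using stays W_def by blast

lemma tendsto_\<phi>: "(f \<longlongrightarrow> z) F \<Longrightarrow> ((\<lambda>x. \<phi> (f x)) \<longlongrightarrow> \<phi> z) F"
  using continuous_on_tendsto_compose[OF locally_lipschitz_continuous_on[OF lip, of UNIV]] by simp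

lemma continuous_on_orbit: "u \<in> W \<Longrightarrow> continuous_on {0..} (\<lambda>s. \<sigma> s u)"
  using continuous_on_compose2[OF cont, of "{0..}" "\<lambda>s. (s, u)"]
  by (auto simp: image_subset_iff continuous_on_Pair continuous_on_id)

text \<open>The edge estimate uses the rate at the earlier point only; a lower bound valid on the
  whole interval lets the pieces be added by the triangle inequality. With
  \<open>\<delta> = 0\<close> this is the monotonicity of \<phi>.\<close>

lemma drop_ge:
  assumes u: "u \<in> W" and st: "0 \<le> s" "s \<le> t" and rate: "\<And>r. r \<in> {s..t} \<Longrightarrow> \<delta> \<le> rate (\<sigma> r u)"
    and \<delta>: "0 \<le> \<delta>"
  shows "\<delta> * dist (\<sigma> s u) (\<sigma> t u) \<le> \<phi> (\<sigma> s u) - \<phi> (\<sigma> t u)"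
proof -
  define Q where "Q s t \<longleftrightarrow> ((\<forall>r\<in>{s..t}. \<delta> \<le> rate (\<sigma> r u)) \<longrightarrow>
    \<delta> * dist (\<sigma> s u) (\<sigma> t u) \<le> \<phi> (\<sigma> s u) - \<phi> (\<sigma> t u))" for s t
  have "Q s t"
  proof (rule unit_interval_chain[of Q, OF _ _ st])
    fix r s t :: real assume "r \<le> s" "s \<le> t" and Q: "Q r s" "Q s t"
    show "Q r t" unfolding Q_def
    proof
      assume "\<forall>x\<in>{r..t}. \<delta> \<le> rate (\<sigma> x u)"
      then have "\<delta> * dist (\<sigma> r u) (\<sigma> s u) \<le> \<phi> (\<sigma> r u) - \<phi> (\<sigma> s u)"
        "\<delta> * dist (\<sigma> s u) (\<sigma> t u) \<le> \<phi> (\<sigma> s u) - \<phi> (\<sigma> t u)"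
        using Q \<open>r \<le> s\<close> \<open>s \<le> t\<close> unfolding Q_def by auto
      moreover have "\<delta> * dist (\<sigma> r u) (\<sigma> t u) \<le> \<delta> * (dist (\<sigma> r u) (\<sigma> s u) + dist (\<sigma> s u) (\<sigma> t u))"
        using \<delta> by (intro mult_left_mono dist_triangle)
      ultimately show "\<delta> * dist (\<sigma> r u) (\<sigma> t u) \<le> \<phi> (\<sigma> r u) - \<phi> (\<sigma> t u)"
        by (simp add: algebra_simps)
    qed
  next
    fix n and r s :: real assume rs: "0 \<le> r" "r \<le> s" "s \<le> 1"
    show "Q (real n + r) (real n + s)" unfolding Q_def
    proof
      assume "\<forall>x\<in>{real n + r..real n + s}. \<delta> \<le> rate (\<sigma> x u)"
      then have "\<delta> * dist (\<sigma> (real n + r) u) (\<sigma> (real n + s) u)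
          \<le> rate (\<sigma> (real n + r) u) * dist (\<sigma> (real n + r) u) (\<sigma> (real n + s) u)"
        using rs by (intro mult_right_mono) auto
      also have "\<dots> \<le> \<phi> (\<sigma> (real n + r) u) - \<phi> (\<sigma> (real n + s) u)"
        unfolding rate_def by (rule edge[OF u rs])
      finally show "\<delta> * dist (\<sigma> (real n + r) u) (\<sigma> (real n + s) u)
          \<le> \<phi> (\<sigma> (real n + r) u) - \<phi> (\<sigma> (real n + s) u)" .
    qed
  qed
  then show ?thesis using rate unfolding Q_def by blast
qed

lemma \<phi>_antimono: "u \<in> W \<Longrightarrow> 0 \<le> s \<Longrightarrow> s \<le> t \<Longrightarrow> \<phi> (\<sigma> t u) \<le> \<phi> (\<sigma> s u)"
  using drop_ge[of u s t 0] rate_nonneg by simp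

lemma \<phi>_le_start: "u \<in> W \<Longrightarrow> 0 \<le> s \<Longrightarrow> \<phi> (\<sigma> s u) \<le> \<phi> u"
  using \<phi>_antimono[of u 0 s] start by simp

text \<open>By \<open>ln x \<le> x - 1\<close>, the growth of \<open>ln (1 + norm)\<close> over a
  piece of an edge is at most its length divided by \<open>1 + norm\<close> at its initial point,
  which is what the edge estimate controls.\<close>

lemma log_drop_ge:
  assumes u: "u \<in> W" and st: "0 \<le> s" "s \<le> t"
    and slope: "\<And>r. r \<in> {s..t} \<Longrightarrow> \<delta> \<le> cerami_slope \<phi> (\<sigma> r u)" and \<delta>: "0 \<le> \<delta>"
  shows "\<delta> / 2 * (ln (1 + norm (\<sigma> t u)) - ln (1 + norm (\<sigma> s u))) \<le> \<phi> (\<sigma> s u) - \<phi> (\<sigma> t u)"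
proof -
  define N where "N s = 1 + norm (\<sigma> s u)" for s
  have N: "N s > 0" for s by (simp add: N_def add_pos_nonneg)
  define Q where "Q s t \<longleftrightarrow> ((\<forall>r\<in>{s..t}. \<delta> \<le> cerami_slope \<phi> (\<sigma> r u)) \<longrightarrow>
    \<delta> / 2 * (ln (N t) - ln (N s)) \<le> \<phi> (\<sigma> s u) - \<phi> (\<sigma> t u))" for s t
  have "Q s t"
  proof (rule unit_interval_chain[of Q, OF _ _ st])
    fix r s t :: real assume "r \<le> s" "s \<le> t" and Q: "Q r s" "Q s t"
    show "Q r t" unfolding Q_def
    proof
      assume "\<forall>x\<in>{r..t}. \<delta> \<le> cerami_slope \<phi> (\<sigma> x u)"
      then have "\<delta> / 2 * (ln (N s) - ln (N r)) \<le> \<phi> (\<sigma> r u) - \<phi> (\<sigma> s u)"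
        "\<delta> / 2 * (ln (N t) - ln (N s)) \<le> \<phi> (\<sigma> s u) - \<phi> (\<sigma> t u)"
        using Q \<open>r \<le> s\<close> \<open>s \<le> t\<close> unfolding Q_def by auto
      then show "\<delta> / 2 * (ln (N t) - ln (N r)) \<le> \<phi> (\<sigma> r u) - \<phi> (\<sigma> t u)"
        by (simp add: algebra_simps)
    qed
  next
    fix n and r s :: real assume rs: "0 \<le> r" "r \<le> s" "s \<le> 1"
    let ?r = "real n + r" and ?s = "real n + s"
    show "Q ?r ?s" unfolding Q_def
    proof
      assume "\<forall>x\<in>{?r..?s}. \<delta> \<le> cerami_slope \<phi> (\<sigma> x u)"
      then have \<delta>r: "\<delta> \<le> cerami_slope \<phi> (\<sigma> ?r u)" using rs by auto
      have "ln (N ?s) - ln (N ?r) = ln (N ?s / N ?r)" using N[of ?r] N[of ?s] by (simp add: ln_div)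
      also have "\<dots> \<le> N ?s / N ?r - 1" using N by (intro ln_le_minus_one) simp
      also have "\<dots> = (N ?s - N ?r) / N ?r" using N[of ?r] by (simp add: field_simps)
      also have "\<dots> \<le> dist (\<sigma> ?r u) (\<sigma> ?s u) / N ?r"
        using N[of ?r] norm_triangle_ineq2[of "\<sigma> ?s u" "\<sigma> ?r u"]
        by (intro divide_right_mono) (auto simp: N_def dist_norm norm_minus_commute)
      finally have "\<delta> / 2 * (ln (N ?s) - ln (N ?r)) \<le> \<delta> / 2 * (dist (\<sigma> ?r u) (\<sigma> ?s u) / N ?r)"
        using \<delta> by (intro mult_left_mono) auto
      also have "\<dots> \<le> cerami_slope \<phi> (\<sigma> ?r u) / 2 * (dist (\<sigma> ?r u) (\<sigma> ?s u) / N ?r)"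
        using \<delta>r N[of ?r] by (intro mult_right_mono) auto
      also have "\<dots> = cerami_slope \<phi> (\<sigma> ?r u) / (2 * (1 + norm (\<sigma> ?r u))) * dist (\<sigma> ?r u) (\<sigma> ?s u)"
        by (simp add: N_def)
      also have "\<dots> \<le> \<phi> (\<sigma> ?r u) - \<phi> (\<sigma> ?s u)" by (rule edge[OF u rs])
      finally show "\<delta> / 2 * (ln (N ?s) - ln (N ?r)) \<le> \<phi> (\<sigma> ?r u) - \<phi> (\<sigma> ?s u)" .
    qed
  qed
  then show ?thesis using slope unfolding Q_def N_def by blast
qed

text \<open>Otherwise levels tending to \<open>a\<close> and rates tending to 0 occur together in
  the bounded annulus, and compactness gives a critical point of level \<open>a\<close> there. The
  inner radius keeps it different from \<open>z\<close>, and \<open>avoid\<close> excludes all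
  others. One \<delta> serves as level window and as rate.\<close>

lemma rate_bounded_below_on_annulus:
  assumes pq: "0 < p" "p \<le> q" and avoid: "\<And>y. y \<in> crit_at \<phi> (ereal a) \<Longrightarrow> y \<noteq> z \<Longrightarrow> q < dist z y"
  obtains \<delta> where "0 < \<delta>"
    "\<And>w. w \<in> W \<Longrightarrow> p \<le> dist w z \<Longrightarrow> dist w z \<le> q \<Longrightarrow> \<phi> w < a + \<delta> \<Longrightarrow> \<delta> \<le> rate w"
proof (rule ccontr)
  assume no: "\<not> thesis"
  have "\<exists>w. w \<in> W \<and> p \<le> dist w z \<and> dist w z \<le> q \<and> \<phi> w < a + inverse (real (Suc n))
      \<and> rate w < inverse (real (Suc n))" for n
  proof (rule ccontr)
    assume "\<not> ?thesis"
    then have "thesis" by (intro that[of "inverse (real (Suc n))"]) (auto simp: not_less)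
    then show False using no by blast
  qed
  then obtain w where w: "\<And>n. w n \<in> W" "\<And>n. p \<le> dist (w n) z" "\<And>n. dist (w n) z \<le> q"
    "\<And>n. \<phi> (w n) < a + inverse (real (Suc n))" "\<And>n. rate (w n) < inverse (real (Suc n))"
    by metis
  \<comment> \<open>A bound for \<open>2 * (1 + norm w)\<close> on the annulus, so that small rates
    mean small slopes.\<close>
  define M where "M = 2 * (1 + norm z + q)"
  have slope_le: "cerami_slope \<phi> (w n) \<le> M * inverse (real (Suc n))" for n
  proof -
    have "norm (w n) \<le> norm z + q"
      using w(3)[of n] norm_triangle_sub[of "w n" z] by (simp add: dist_norm)
    then have le: "2 * (1 + norm (w n)) \<le> M" by (simp add: M_def)
    have "1 + norm (w n) \<noteq> 0" using norm_ge_zero[of "w n"] by linarith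
    then have "cerami_slope \<phi> (w n) = 2 * (1 + norm (w n)) * rate (w n)"
      by (simp add: rate_def)
    also have "\<dots> \<le> M * inverse (real (Suc n))"
      using le w(5)[of n] rate_nonneg[of "w n"] by (intro mult_mono) (use pq in \<open>auto simp: M_def intro!: add_nonneg_nonneg\<close>)
    finally show ?thesis .
  qed
  have M0: "(\<lambda>n. M * inverse (real (Suc n))) \<longlonglongrightarrow> 0"
    using tendsto_mult[OF tendsto_const LIMSEQ_inverse_real_of_nat, of M] by simp
  have slope0: "(\<lambda>n. cerami_slope \<phi> (w n)) \<longlonglongrightarrow> 0"
    by (rule tendsto_sandwich[OF _ _ tendsto_const M0];
        intro always_eventually allI cerami_slope_nonneg[OF lip] slope_le)
  have a0: "(\<lambda>n. a + inverse (real (Suc n))) \<longlonglongrightarrow> a"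
    using tendsto_add[OF tendsto_const LIMSEQ_inverse_real_of_nat, of a] by simp
  have "a \<le> \<phi> (w n)" for n using w(1)[of n] W_def by (metis (mono_tags) less_imp_le mem_Collect_eq)
  then have lim\<phi>: "(\<lambda>n. \<phi> (w n)) \<longlonglongrightarrow> a"
    by (intro tendsto_sandwich[OF _ _ tendsto_const a0] always_eventually allI less_imp_le[OF w(4)])
  then obtain r y where r: "strict_mono (r :: nat \<Rightarrow> nat)" "(\<lambda>n. w (r n)) \<longlonglongrightarrow> y" "y \<in> crit \<phi>"
    using cerami_slope_compactness[OF lip cer slope0] convergent_imp_bounded by metis
  have "\<phi> y = a"
    using LIMSEQ_unique[OF tendsto_\<phi>[OF r(2)]] LIMSEQ_subseq_LIMSEQ[OF lim\<phi> r(1)] by (simp add: o_def)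
  moreover have d: "(\<lambda>n. dist (w (r n)) z) \<longlonglongrightarrow> dist y z" by (intro tendsto_intros r(2))
  have "p \<le> dist y z" by (rule LIMSEQ_le_const[OF d]) (use w(2) in auto)
  moreover have "dist y z \<le> q" by (rule LIMSEQ_le_const2[OF d]) (use w(3) in auto)
  ultimately show False
    using avoid[of y] r(3) pq by (cases "y = z") (auto simp: crit_at_def dist_commute)
qed

text \<open>\<eta> works for all starting points and all times simultaneously; continuity of the
  limit rests on this uniformity.\<close>

lemma stable:
  assumes z: "\<phi> z = a" and e: "0 < e"
  obtains \<eta> where "0 < \<eta>"
    "\<And>u s t. u \<in> W \<Longrightarrow> 0 \<le> s \<Longrightarrow> dist (\<sigma> s u) z < \<eta> \<Longrightarrow> s \<le> t \<Longrightarrow> dist (\<sigma> t u) z < e"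
proof -
  obtain d where d: "d > 0" "\<And>y. y \<in> crit_at \<phi> (ereal a) \<Longrightarrow> y \<noteq> z \<Longrightarrow> d \<le> dist z y"
    using finite_set_avoid[OF fin, of z] by blast
  define q where "q = min e (d/2)"
  have q: "0 < q" "q \<le> e" "q < d" using e d(1) by (auto simp: q_def)
  have "q < dist z y" if "y \<in> crit_at \<phi> (ereal a)" "y \<noteq> z" for y
    using d(2)[OF that] q(3) by linarith
  then obtain \<delta> where \<delta>: "0 < \<delta>"
    "\<And>w. w \<in> W \<Longrightarrow> q/2 \<le> dist w z \<Longrightarrow> dist w z \<le> q \<Longrightarrow> \<phi> w < a + \<delta> \<Longrightarrow> \<delta> \<le> rate w"
    using rate_bounded_below_on_annulus[of "q/2" q z] q(1) by auto
  \<comment> \<open>Crossing the annulus costs at least \<open>\<delta> * q / 2\<close>, while the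
    drop still available above level \<open>a\<close> is less than \<open>\<delta> * q / 4\<close>.
    The bound by \<delta> keeps the orbit in the level window where the rate is controlled.\<close>
  define m where "m = min \<delta> (\<delta> * q / 4)"
  have m: "0 < m" "m \<le> \<delta>" "m \<le> \<delta> * q / 4" using \<delta>(1) q(1) by (auto simp: m_def)
  have "isCont \<phi> z"
    using locally_lipschitz_continuous_on[OF lip, of UNIV] by (simp add: continuous_on_eq_continuous_at)
  then obtain d1 where d1: "d1 > 0" "\<And>x. dist x z < d1 \<Longrightarrow> dist (\<phi> x) (\<phi> z) < m"
    using m(1) unfolding continuous_at_eps_delta by blast
  show thesis
  proof (rule that[of "min d1 (q/2)"])
    show "0 < min d1 (q/2)" using d1 q by simp
    fix u s0 T assume u: "u \<in> W" and s0: "0 \<le> s0" "dist (\<sigma> s0 u) z < min d1 (q/2)" "s0 \<le> T"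
    have \<phi>s0: "\<phi> (\<sigma> s0 u) < a + m"
      using d1(2)[of "\<sigma> s0 u"] s0(2) z by (simp add: dist_real_def abs_less_iff)
    show "dist (\<sigma> T u) z < e"
    proof (rule ccontr)
      assume "\<not> dist (\<sigma> T u) z < e"
      then have far: "q \<le> dist (\<sigma> T u) z" using q(2) by simp
      have "continuous_on {s0..T} (\<lambda>s. dist (\<sigma> s u) z)"
        using s0(1) by (intro continuous_intros continuous_on_subset[OF continuous_on_orbit[OF u]]) auto
      then obtain s t where st: "s0 \<le> s" "s \<le> t" "t \<le> T" "dist (\<sigma> s u) z = q/2" "dist (\<sigma> t u) z = q"
        and ann: "\<And>r. r \<in> {s..t} \<Longrightarrow> q/2 \<le> dist (\<sigma> r u) z \<and> dist (\<sigma> r u) z \<le> q"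
        using annulus_crossing[of s0 T "\<lambda>s. dist (\<sigma> s u) z" "q/2" q] s0 far q(1) by auto
      have "\<delta> \<le> rate (\<sigma> r u)" if "r \<in> {s..t}" for r
      proof (rule \<delta>(2))
        show "\<sigma> r u \<in> W" using that st s0(1) u by (intro stays) auto
        have "\<phi> (\<sigma> r u) \<le> \<phi> (\<sigma> s0 u)" using that st s0(1) by (intro \<phi>_antimono[OF u]) auto
        then show "\<phi> (\<sigma> r u) < a + \<delta>" using \<phi>s0 m(2) by linarith
      qed (use ann[OF that] in auto)
      then have "\<delta> * dist (\<sigma> s u) (\<sigma> t u) \<le> \<phi> (\<sigma> s u) - \<phi> (\<sigma> t u)"
        using st s0(1) \<delta>(1) by (intro drop_ge[OF u]) auto
      moreover have "\<phi> (\<sigma> s u) \<le> \<phi> (\<sigma> s0 u)" using st s0(1) by (intro \<phi>_antimono[OF u]) auto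
      moreover have "a < \<phi> (\<sigma> t u)" using st s0(1) by (intro level_gt u) auto
      moreover have "q / 2 \<le> dist (\<sigma> s u) (\<sigma> t u)"
        using st(4,5) dist_triangle[of "\<sigma> t u" z "\<sigma> s u"] by (simp add: dist_commute)
      then have "\<delta> * (q / 2) \<le> \<delta> * dist (\<sigma> s u) (\<sigma> t u)"
        using \<delta>(1) by (intro mult_left_mono) auto
      moreover have "\<delta> * q > 0" using \<delta>(1) q(1) by simp
      ultimately show False using \<phi>s0 m(3) by (simp add: field_simps)
    qed
  qed
qed

section \<open>Convergence of the polygons\<close>

lemma converges_of_cluster_point:
  assumes u: "u \<in> W" and s: "\<And>n::nat. real n \<le> s n" and lim: "(\<lambda>n. \<sigma> (s n) u) \<longlonglongrightarrow> z" and z: "\<phi> z = a"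
  shows "((\<lambda>s. \<sigma> s u) \<longlongrightarrow> z) at_top"
proof (rule tendstoI)
  fix e :: real assume "e > 0"
  then obtain \<eta> where \<eta>: "0 < \<eta>"
    "\<And>s t. 0 \<le> s \<Longrightarrow> dist (\<sigma> s u) z < \<eta> \<Longrightarrow> s \<le> t \<Longrightarrow> dist (\<sigma> t u) z < e"
    using stable[OF z, of e] u by metis
  obtain n where n: "dist (\<sigma> (s n) u) z < \<eta>"
    using lim \<eta>(1) unfolding lim_sequentially by blast
  have "0 \<le> s n" using s[of n] by linarith
  then show "eventually (\<lambda>t. dist (\<sigma> t u) z < e) at_top"
    using \<eta>(2)[OF _ n] unfolding eventually_at_top_linorder by blast
qed

text \<open>The strict drop over the first unit of time puts the limit strictly below
  \<open>b\<close>, even when \<open>\<phi> u = b\<close>. So a limit above level \<open>a\<close>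
  is noncritical and lies in \<open>W\<close>.\<close>

lemma cluster_point_level:
  assumes u: "u \<in> W" and s: "\<And>n::nat. real n \<le> s n" and lim: "(\<lambda>n. \<sigma> (s n) u) \<longlonglongrightarrow> z"
  shows "\<phi> z = a \<or> z \<in> W"
proof -
  have s0: "0 \<le> s n" for n using s[of n] by linarith
  have "a \<le> \<phi> z"
    using level_gt[OF s0 u] by (intro LIMSEQ_le_const[OF tendsto_\<phi>[OF lim]]) (auto intro: less_imp_le)
  moreover have "\<phi> z \<le> \<phi> (\<sigma> 1 u)"
  proof (rule LIMSEQ_le_const2[OF tendsto_\<phi>[OF lim]], intro exI[of _ 1] allI impI)
    fix n :: nat assume "1 \<le> n"
    then show "\<phi> (\<sigma> (s n) u) \<le> \<phi> (\<sigma> 1 u)"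
      using s[of n] by (intro \<phi>_antimono[OF u]) auto
  qed
  then have "\<phi> z < \<phi> u" using strict[OF u] by simp
  then have "ereal (\<phi> z) < b" using u W_def by (metis (mono_tags) ereal_less(2) less_ereal.simps(1) mem_Collect_eq order_less_le_trans)
  ultimately show ?thesis
    using nocrit[of "\<phi> z"] unfolding W_def crit_at_def by force
qed

text \<open>If the slope stays above a positive number, the logarithmic estimate bounds the orbit,
  hence the rate is bounded below and the vertices form a Cauchy sequence, whose limit cannot lie in
  \<open>W\<close>. If not, the slope tends to 0 along times tending to infinity, and compactness
  gives a critical cluster point, again outside \<open>W\<close>. Stability turns these points into
  limits in continuous time.\<close>

lemma orbit_converges:
  assumes u: "u \<in> W"
  obtains z where "\<phi> z = a" "((\<lambda>s. \<sigma> s u) \<longlongrightarrow> z) at_top"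
proof (cases "\<exists>\<delta>>0. \<exists>s0\<ge>0. \<forall>s\<ge>s0. \<delta> \<le> cerami_slope \<phi> (\<sigma> s u)")
  case True
  then obtain \<delta> s0 where \<delta>: "\<delta> > 0" "s0 \<ge> 0" "\<And>s. s \<ge> s0 \<Longrightarrow> \<delta> \<le> cerami_slope \<phi> (\<sigma> s u)"
    by blast
  define R where "R = exp (ln (1 + norm (\<sigma> s0 u)) + 2 / \<delta> * (\<phi> u - a))"
  have R: "1 + norm (\<sigma> s u) \<le> R" if "s \<ge> s0" for s
  proof -
    have "\<delta> / 2 * (ln (1 + norm (\<sigma> s u)) - ln (1 + norm (\<sigma> s0 u))) \<le> \<phi> (\<sigma> s0 u) - \<phi> (\<sigma> s u)"
      using \<delta> that by (intro log_drop_ge[OF u]) auto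
    also have "\<dots> \<le> \<phi> u - a"
      using \<phi>_le_start[OF u \<delta>(2)] level_gt[of s u] u \<delta>(2) that by simp
    finally have "ln (1 + norm (\<sigma> s u)) \<le> ln (1 + norm (\<sigma> s0 u)) + 2 / \<delta> * (\<phi> u - a)"
      using \<delta>(1) by (simp add: field_simps)
    then show ?thesis
      unfolding R_def by (metis add_pos_nonneg exp_le_cancel_iff exp_ln norm_ge_zero zero_less_one)
  qed
  have Rpos: "R > 0" by (simp add: R_def)
  define \<kappa> where "\<kappa> = \<delta> / (2 * R)"
  have \<kappa>: "\<kappa> > 0" using \<delta>(1) Rpos by (simp add: \<kappa>_def)
  have rate: "\<kappa> \<le> rate (\<sigma> s u)" if "s \<ge> s0" for s
    unfolding \<kappa>_def rate_def using \<delta>(1) \<delta>(3)[OF that] R[OF that]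
    by (intro frac_le) (auto intro: add_pos_nonneg)
  have "decseq (\<lambda>n. \<phi> (\<sigma> (real n) u))"
    by (intro decseq_SucI \<phi>_antimono[OF u]) auto
  then obtain l where "(\<lambda>n. \<phi> (\<sigma> (real n) u)) \<longlonglongrightarrow> l"
    using decseq_convergent[of _ a] level_gt[OF _ u] by (metis less_imp_le of_nat_0_le_iff)
  then have cau\<phi>: "Cauchy (\<lambda>n. \<phi> (\<sigma> (real n) u))" by (rule LIMSEQ_imp_Cauchy)
  have "Cauchy (\<lambda>n. \<sigma> (real n) u)"
  proof (rule metric_CauchyI)
    fix e :: real assume "e > 0"
    then obtain M where M: "\<And>m n. m \<ge> M \<Longrightarrow> n \<ge> M \<Longrightarrow> dist (\<phi> (\<sigma> (real m) u)) (\<phi> (\<sigma> (real n) u)) < \<kappa> * e"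
      using metric_CauchyD[OF cau\<phi>, of "\<kappa> * e"] \<kappa> by auto
    obtain M' where M': "s0 \<le> real M'" using real_arch_simple by blast
    have le: "dist (\<sigma> (real m) u) (\<sigma> (real n) u) < e" if "m \<ge> max M M'" "m \<le> n" for m n
    proof -
      have "\<kappa> * dist (\<sigma> (real m) u) (\<sigma> (real n) u) \<le> \<phi> (\<sigma> (real m) u) - \<phi> (\<sigma> (real n) u)"
        using that \<kappa> M' by (intro drop_ge[OF u] rate) auto
      also have "\<dots> < \<kappa> * e" using M[of m n] that by (simp add: dist_real_def abs_less_iff)
      finally show ?thesis using \<kappa> by simp
    qed
    show "\<exists>M. \<forall>m\<ge>M. \<forall>n\<ge>M. dist (\<sigma> (real m) u) (\<sigma> (real n) u) < e"
    proof (intro exI[of _ "max M M'"] allI impI)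
      fix m n assume "max M M' \<le> m" "max M M' \<le> n"
      then show "dist (\<sigma> (real m) u) (\<sigma> (real n) u) < e"
        using le[of m n] le[of n m] by (cases "m \<le> n") (auto simp: dist_commute)
    qed
  qed
  then obtain z where z: "(\<lambda>n. \<sigma> (real n) u) \<longlonglongrightarrow> z"
    using Cauchy_convergent convergent_def by blast
  have "\<phi> z = a" using cluster_point_level[OF u _ z] no_stall[OF u z] by simp
  then show thesis using that converges_of_cluster_point[OF u _ z] by simp
next
  case False
  have "\<exists>s\<ge>real n. cerami_slope \<phi> (\<sigma> s u) < inverse (real (Suc n))" for n
    using False by (metis inverse_positive_iff_positive not_le of_nat_0_le_iff of_nat_0_less_iff zero_less_Suc)
  then obtain s where s: "\<And>n. real n \<le> s n" "\<And>n. cerami_slope \<phi> (\<sigma> (s n) u) < inverse (real (Suc n))"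
    by metis
  have s0: "0 \<le> s n" for n using s(1)[of n] by linarith
  have "(\<lambda>n. cerami_slope \<phi> (\<sigma> (s n) u)) \<longlonglongrightarrow> 0"
    by (rule tendsto_sandwich[OF _ _ tendsto_const LIMSEQ_inverse_real_of_nat])
       (use s(2) cerami_slope_nonneg[OF lip] in \<open>auto intro!: always_eventually less_imp_le\<close>)
  moreover have "bounded (range (\<lambda>n. \<phi> (\<sigma> (s n) u)))"
  proof (rule bounded_subset[OF bounded_closed_interval[of a "\<phi> u"]], clarify)
    fix n
    show "\<phi> (\<sigma> (s n) u) \<in> {a..\<phi> u}"
      using level_gt[OF s0 u, of n] \<phi>_le_start[OF u s0, of n] by simp
  qed
  ultimately obtain r z where r: "strict_mono (r :: nat \<Rightarrow> nat)" "(\<lambda>n. \<sigma> (s (r n)) u) \<longlonglongrightarrow> z" "z \<in> crit \<phi>"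
    using cerami_slope_compactness[OF lip cer, of "\<lambda>n. \<sigma> (s n) u"] by metis
  have sr: "real n \<le> s (r n)" for n
    using s(1)[of "r n"] seq_suble[OF r(1), of n] by linarith
  have "\<phi> z = a" using cluster_point_level[OF u sr r(2)] r(3) W_def by blast
  then show thesis using that converges_of_cluster_point[OF u sr r(2)] by simp
qed

section \<open>The homotopy and its continuity\<close>

definition endpoint :: "'a \<Rightarrow> 'a" where
  "endpoint u = (SOME z. \<phi> z = a \<and> ((\<lambda>s. \<sigma> s u) \<longlongrightarrow> z) at_top)"

lemma endpoint:
  assumes "u \<in> W"
  shows "\<phi> (endpoint u) = a" "((\<lambda>s. \<sigma> s u) \<longlongrightarrow> endpoint u) at_top"
proof -
  have "\<exists>z. \<phi> z = a \<and> ((\<lambda>s. \<sigma> s u) \<longlongrightarrow> z) at_top"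
    using orbit_converges[OF assms] by metis
  from someI_ex[OF this]
  show "\<phi> (endpoint u) = a" "((\<lambda>s. \<sigma> s u) \<longlongrightarrow> endpoint u) at_top"
    unfolding endpoint_def by auto
qed

text \<open>At \<open>t = 1\<close> the quotient \<open>t / (1 - t)\<close> is 0 by convention and
  would return the starting point, hence the separate branch for the limit.\<close>

definition homotopy :: "real \<Rightarrow> 'a \<Rightarrow> 'a" where
  "homotopy t u = (if \<phi> u \<le> a then u else if t < 1 then \<sigma> (t / (1 - t)) u else endpoint u)"

text \<open>\<open>s / (1 + s)\<close> is the compressed time corresponding to \<open>s\<close>. The
  bound is not strict because at \<open>t = 1\<close> it is inherited by a limit.\<close>

lemma homotopy_tail:
  assumes u: "u \<in> W" and s: "0 \<le> s" and t: "s / (1 + s) \<le> t" "t \<le> 1"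
    and near: "\<And>r. s \<le> r \<Longrightarrow> dist (\<sigma> r u) z < e"
  shows "dist (homotopy t u) z \<le> e"
proof -
  have au: "\<not> \<phi> u \<le> a" using u W_def by auto
  show ?thesis
  proof (cases "t < 1")
    case True
    then have "s \<le> t / (1 - t)" using t s by (simp add: field_simps)
    then have "dist (\<sigma> (t / (1 - t)) u) z < e" by (rule near)
    then show ?thesis using au True by (simp add: homotopy_def)
  next
    case False
    have "((\<lambda>s. dist (\<sigma> s u) z) \<longlongrightarrow> dist (endpoint u) z) at_top"
      by (intro tendsto_intros endpoint(2)[OF u])
    moreover have "eventually (\<lambda>r. dist (\<sigma> r u) z \<le> e) at_top"
      using near unfolding eventually_at_top_linorder by (blast intro: less_imp_le)
    ultimately have "dist (endpoint u) z \<le> e" by (intro tendsto_upperbound) auto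
    then show ?thesis using au False by (simp add: homotopy_def)
  qed
qed

lemma homotopy_cases:
  assumes "u \<in> W" "t \<in> {0..1}"
  shows "homotopy t u \<in> W \<or> \<phi> (homotopy t u) = a" "\<phi> (homotopy t u) \<le> \<phi> u"
proof -
  have au: "a < \<phi> u" using assms(1) W_def by blast
  have "homotopy t u \<in> W \<and> \<phi> (homotopy t u) \<le> \<phi> u \<or> \<phi> (homotopy t u) = a"
  proof (cases "t < 1")
    case True
    then have "0 \<le> t / (1 - t)" using assms(2) by simp
    then show ?thesis
      using stays[of "t / (1 - t)" u] \<phi>_le_start[of u "t / (1 - t)"] assms(1) au True
      by (simp add: homotopy_def)
  next
    case False
    then show ?thesis using endpoint(1)[OF assms(1)] au by (simp add: homotopy_def)
  qed
  then show "homotopy t u \<in> W \<or> \<phi> (homotopy t u) = a" "\<phi> (homotopy t u) \<le> \<phi> u"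
    using au by auto
qed

lemma continuous_on_homotopy:
  "continuous_on ({0..1} \<times> (W \<union> {u. \<phi> u \<le> a})) (\<lambda>(t, u). homotopy t u)"
  unfolding continuous_on_def
proof
  fix x0 assume x0: "x0 \<in> {0..1::real} \<times> (W \<union> {u. \<phi> u \<le> a})"
  obtain t0 u0 where x0_eq: "x0 = (t0, u0)" by force
  have t0: "0 \<le> t0" "t0 \<le> 1" and u0: "u0 \<in> W \<or> \<phi> u0 \<le> a" using x0 x0_eq by auto
  let ?S = "{0..1::real} \<times> (W \<union> {u. \<phi> u \<le> a})"
  let ?F = "at (t0, u0) within ?S"
  have inS: "eventually (\<lambda>x. x \<in> ?S) ?F" by (simp add: eventually_at_filter)
  have fst: "(fst \<longlongrightarrow> t0) ?F" and snd: "(snd \<longlongrightarrow> u0) ?F"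
    using tendsto_fst[OF tendsto_ident_at, of "(t0, u0)" ?S] tendsto_snd[OF tendsto_ident_at, of "(t0, u0)" ?S]
    by simp_all
  note lim\<phi> = tendsto_\<phi>[OF snd]
  have "((\<lambda>x. homotopy (fst x) (snd x)) \<longlongrightarrow> homotopy t0 u0) ?F"
  proof (cases "\<phi> u0" a rule: linorder_cases)
    case less
    have "eventually (\<lambda>x. snd x = homotopy (fst x) (snd x)) ?F"
      using order_tendstoD(2)[OF lim\<phi> less] by eventually_elim (simp add: homotopy_def)
    then have "((\<lambda>x. homotopy (fst x) (snd x)) \<longlongrightarrow> u0) ?F"
      using snd by (rule Lim_transform_eventually[rotated])
    then show ?thesis using less by (simp add: homotopy_def)
  next
    case equal
    \<comment> \<open>Orbits starting near a point of level \<open>a\<close> are near it at time 0,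
      so stability confines them to its neighbourhood for all times, the limit included.\<close>
    have h0: "homotopy t0 u0 = u0" using equal by (simp add: homotopy_def)
    show ?thesis
    proof (rule tendstoI)
      fix e :: real assume e: "e > 0"
      then obtain \<eta> where \<eta>: "0 < \<eta>"
        "\<And>u s t. u \<in> W \<Longrightarrow> 0 \<le> s \<Longrightarrow> dist (\<sigma> s u) u0 < \<eta> \<Longrightarrow> s \<le> t \<Longrightarrow> dist (\<sigma> t u) u0 < e/2"
        using stable[OF equal, of "e/2"] by (metis half_gt_zero)
      have "eventually (\<lambda>x. dist (snd x) u0 < min \<eta> e) ?F"
        using \<eta>(1) e by (intro tendstoD[OF snd]) auto
      then show "eventually (\<lambda>x. dist (homotopy (fst x) (snd x)) (homotopy t0 u0) < e) ?F"
        using inS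
      proof eventually_elim
        case (elim x)
        show ?case
        proof (cases "\<phi> (snd x) \<le> a")
          case True
          then show ?thesis using elim(1) h0 by (simp add: homotopy_def)
        next
          case False
          then have W: "snd x \<in> W" using elim(2) by auto
          have "dist (homotopy (fst x) (snd x)) u0 \<le> e/2"
          proof (rule homotopy_tail[OF W, of 0])
            fix r :: real assume "0 \<le> r"
            then show "dist (\<sigma> r (snd x)) u0 < e/2"
              using \<eta>(2)[OF W, of 0 r] elim(1) by (simp add: start)
          qed (use elim(2) in auto)
          then show ?thesis using e h0 by simp
        qed
      qed
    qed
  next
    case greater
    then have W0: "u0 \<in> W" using u0 by auto
    have evW: "eventually (\<lambda>x. x \<in> {0..1} \<times> W) ?F"
      using order_tendstoD(1)[OF lim\<phi> greater] inS by eventually_elim auto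
    show ?thesis
    proof (cases "t0 < 1")
      case True
      have ev: "eventually (\<lambda>x. fst x < 1) ?F" by (rule order_tendstoD(2)[OF fst True])
      have "((\<lambda>x. (fst x / (1 - fst x), snd x)) \<longlongrightarrow> (t0 / (1 - t0), u0)) ?F"
        using True by (intro tendsto_intros fst snd) auto
      then have "((\<lambda>x. case (fst x / (1 - fst x), snd x) of (s, u) \<Rightarrow> \<sigma> s u) \<longlongrightarrow>
          (case (t0 / (1 - t0), u0) of (s, u) \<Rightarrow> \<sigma> s u)) ?F"
      proof (rule continuous_on_tendsto_compose[OF cont])
        show "eventually (\<lambda>x. (fst x / (1 - fst x), snd x) \<in> {0..} \<times> W) ?F"
          using evW ev by eventually_elim auto
      qed (use True t0 W0 in auto)
      moreover have "eventually (\<lambda>x. (case (fst x / (1 - fst x), snd x) of (s, u) \<Rightarrow> \<sigma> s u) =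
          homotopy (fst x) (snd x)) ?F"
        using evW ev by eventually_elim (auto simp: homotopy_def W_def)
      ultimately have "((\<lambda>x. homotopy (fst x) (snd x)) \<longlongrightarrow> \<sigma> (t0 / (1 - t0)) u0) ?F"
        unfolding prod.case by (rule Lim_transform_eventually)
      then show ?thesis using greater True by (simp add: homotopy_def)
    next
      case False
      then have t01: "t0 = 1" using t0 by simp
      define z where "z = homotopy t0 u0"
      have z: "z = endpoint u0" using t01 greater by (simp add: z_def homotopy_def)
      have \<phi>z: "\<phi> z = a" using endpoint(1)[OF W0] z by simp
      show ?thesis unfolding z_def[symmetric]
      proof (rule tendstoI)
        fix e :: real assume e: "e > 0"
        then obtain \<eta> where \<eta>: "0 < \<eta>"
          "\<And>u s t. u \<in> W \<Longrightarrow> 0 \<le> s \<Longrightarrow> dist (\<sigma> s u) z < \<eta> \<Longrightarrow> s \<le> t \<Longrightarrow> dist (\<sigma> t u) z < e/2"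
          using stable[OF \<phi>z, of "e/2"] by (metis half_gt_zero)
        \<comment> \<open>A single finite time \<open>s\<close> suffices: there the orbit of
          \<open>u0\<close> is within \<eta> of its limit, continuity of the flow at that time
          transfers this to nearby starting points, and stability takes over afterwards.\<close>
        have "eventually (\<lambda>s. dist (\<sigma> s u0) z < \<eta> \<and> 0 \<le> s) at_top"
          using tendstoD[OF endpoint(2)[OF W0] \<eta>(1)] eventually_ge_at_top[of 0] z
          by (simp add: eventually_conj_iff)
        then obtain s where s: "dist (\<sigma> s u0) z < \<eta>" "0 \<le> s"
          using eventually_happens'[OF trivial_limit_at_top_linorder] by blast
        have "((\<lambda>x. case (s, snd x) of (s, u) \<Rightarrow> \<sigma> s u) \<longlongrightarrow> (case (s, u0) of (s, u) \<Rightarrow> \<sigma> s u)) ?F"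
        proof (rule continuous_on_tendsto_compose[OF cont])
          show "eventually (\<lambda>x. (s, snd x) \<in> {0..} \<times> W) ?F"
            using evW by eventually_elim (use s(2) in auto)
        qed (use s(2) W0 in \<open>auto intro!: tendsto_intros snd\<close>)
        then have "((\<lambda>x. dist (\<sigma> s (snd x)) z) \<longlongrightarrow> dist (\<sigma> s u0) z) ?F"
          by (intro tendsto_intros) simp
        then have ev1: "eventually (\<lambda>x. dist (\<sigma> s (snd x)) z < \<eta>) ?F"
          using s(1) by (rule order_tendstoD)
        have "s / (1 + s) < t0" using s(2) t01 by simp
        then have ev2: "eventually (\<lambda>x. s / (1 + s) < fst x) ?F"
          by (rule order_tendstoD(1)[OF fst])
        show "eventually (\<lambda>x. dist (homotopy (fst x) (snd x)) z < e) ?F"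
          using ev1 ev2 evW
        proof eventually_elim
          case (elim x)
          then have W: "snd x \<in> W" and "fst x \<le> 1" by auto
          have "dist (homotopy (fst x) (snd x)) z \<le> e/2"
            using \<eta>(2)[OF W s(2) elim(1)] elim(2) \<open>fst x \<le> 1\<close>
            by (intro homotopy_tail[OF W s(2)]) auto
          then show ?case using e by simp
        qed
      qed
    qed
  qed
  then show "((\<lambda>(t, u). homotopy t u) \<longlongrightarrow> (case x0 of (t, u) \<Rightarrow> homotopy t u)) (at x0 within ?S)"
    by (simp add: x0_eq case_prod_unfold)
qed

end

theorem theorem2p6:
  fixes \<phi> :: "'a::banach \<Rightarrow> real" and a :: real and b :: ereal
  assumes "reflexive_space TYPE('a)"
    and "locally_lipschitz \<phi>"
    and "cerami \<phi>"
    and "ereal a < b"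
    and "finite (crit_at \<phi> (ereal a))"
    and "\<forall>c::real. ereal a < ereal c \<and> ereal c < b \<longrightarrow> crit_at \<phi> (ereal c) = {}"
  shows "\<exists>h :: real \<Rightarrow> 'a \<Rightarrow> 'a.
     continuous_on ({0..1} \<times> (sublevel \<phi> b - crit_at \<phi> b)) (\<lambda>(t, u). h t u) \<and>
     (\<forall>t\<in>{0..1}. \<forall>u\<in>sublevel \<phi> b - crit_at \<phi> b. h t u \<in> sublevel \<phi> b - crit_at \<phi> b) \<and>
     (\<forall>u\<in>sublevel \<phi> b - crit_at \<phi> b. h 0 u = u \<and> h 1 u \<in> sublevel \<phi> (ereal a)) \<and>
     (\<forall>t\<in>{0..1}. \<forall>u\<in>sublevel \<phi> (ereal a). h t u = u) \<and>
     (\<forall>t\<in>{0..1}. \<forall>u\<in>sublevel \<phi> b - crit_at \<phi> b. \<phi> (h t u) \<le> \<phi> u)"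
proof -
  note lip = assms(2) and cer = assms(3)
  have nocrit: "crit_at \<phi> (ereal c) = {}" if "a < c" "ereal c < b" for c
    using assms(6) that by simp
  define W where "W = {u. a < \<phi> u \<and> ereal (\<phi> u) \<le> b \<and> u \<notin> crit \<phi>}"
  \<comment> \<open>Since the slope is at most \<open>(1 + norm u) * mnorm \<phi> u\<close>, the
    factor 2 yields the strict inequality \<open>k u < mnorm \<phi> u\<close> that a direction of
    descent requires.\<close>
  define k where "k u = cerami_slope \<phi> u / (2 * (1 + norm u))" for u
  have npos: "0 < 1 + norm u" for u :: 'a by (simp add: add_pos_nonneg)
  have kcont: "continuous_on UNIV k"
    unfolding k_def
  proof (intro continuous_intros continuous_on_cerami_slope[OF lip] ballI)
    show "2 * (1 + norm u) \<noteq> 0" for u :: 'a using npos[of u] by simp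
  qed
  have kpos: "0 < k u" if "u \<in> W" for u
    using that cerami_slope_pos[OF lip cer, of u] npos[of u] by (simp add: W_def k_def)
  have desc: "\<exists>v. norm v \<le> 1 \<and> clarke_dd \<phi> u v < - k u" if "u \<in> W" for u
  proof -
    have "(1 + norm u) * (2 * k u) = cerami_slope \<phi> u"
      using npos[of u] by (simp add: k_def divide_simps)
    also have "\<dots> \<le> (1 + norm u) * mnorm \<phi> u"
      using cerami_slope_le[OF lip, of u u] by simp
    finally have "2 * k u \<le> mnorm \<phi> u"
      using npos[of u] by (rule mult_left_le_imp_le)
    then have "k u < mnorm \<phi> u" using kpos[OF that] by simp
    then show ?thesis using descent_direction[OF lip, of "k u" u] kpos[OF that] by (metis less_imp_le)
  qed
  have A: "open {u. a < \<phi> u}"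
    using locally_lipschitz_continuous_on[OF lip] by (intro open_Collect_less continuous_on_const)
  have WA: "W \<subseteq> {u. a < \<phi> u}" by (auto simp: W_def)
  have down: "w \<in> W" if "u \<in> W" "w \<in> {u. a < \<phi> u}" "\<phi> w < \<phi> u" for u w
  proof -
    have "ereal (\<phi> w) < ereal (\<phi> u)" using that by simp
    also have "\<dots> \<le> b" using that by (simp add: W_def)
    finally show ?thesis using nocrit[of "\<phi> w"] that by (auto simp: W_def crit_at_def less_imp_le)
  qed
  obtain S :: "real \<Rightarrow> 'a \<Rightarrow> 'a" where S: "continuous_on ({0..1} \<times> W) (\<lambda>(r, u). S r u)"
    "\<And>u. S 0 u = u" "\<And>r u. r \<in> {0..1} \<Longrightarrow> u \<in> W \<Longrightarrow> S r u \<in> W"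
    "\<And>u. u \<in> W \<Longrightarrow> \<phi> (S 1 u) < \<phi> u"
    "\<And>r s u. u \<in> W \<Longrightarrow> 0 \<le> r \<Longrightarrow> r \<le> s \<Longrightarrow> s \<le> 1 \<Longrightarrow>
       k (S r u) * dist (S r u) (S s u) \<le> \<phi> (S r u) - \<phi> (S s u)"
    by (rule descent_step[OF lip kcont kpos desc A WA], assumption, assumption, erule (2) down,
        rule that; assumption)
  obtain \<sigma> :: "real \<Rightarrow> 'a \<Rightarrow> 'a" where \<sigma>: "continuous_on ({0..} \<times> W) (\<lambda>(s, u). \<sigma> s u)" "\<And>u. \<sigma> 0 u = u"
    "\<And>s u. s \<ge> 0 \<Longrightarrow> u \<in> W \<Longrightarrow> \<sigma> s u \<in> W"
    "\<And>n r u. r \<in> {0..1} \<Longrightarrow> \<sigma> (real n + r) u = S r (\<sigma> (real n) u)"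
    by (rule iterate_homotopy[OF S(1-3)], assumption, assumption, rule that; assumption)
  interpret cerami_descent \<phi> a b W \<sigma>
  proof
    fix n :: nat and r s :: real and u assume "u \<in> W" "0 \<le> r" "r \<le> s" "s \<le> 1"
    then show "cerami_slope \<phi> (\<sigma> (real n + r) u) / (2 * (1 + norm (\<sigma> (real n + r) u)))
        * dist (\<sigma> (real n + r) u) (\<sigma> (real n + s) u)
      \<le> \<phi> (\<sigma> (real n + r) u) - \<phi> (\<sigma> (real n + s) u)"
      using S(5)[OF \<sigma>(3), of "real n" u r s] \<sigma>(4)[of r n u] \<sigma>(4)[of s n u] by (simp add: k_def)
  next
    fix u assume "u \<in> W"
    then show "\<phi> (\<sigma> 1 u) < \<phi> u" using S(4)[of u] \<sigma>(4)[of 1 0 u] \<sigma>(2) by simp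
  next
    fix u z assume u: "u \<in> W" and lim: "(\<lambda>n. \<sigma> (real n) u) \<longlonglongrightarrow> z"
    show "z \<notin> W"
    proof
      assume z: "z \<in> W"
      have "continuous_on W (S 1)"
        using continuous_on_compose2[OF S(1), of W "\<lambda>u. (1, u)"]
          continuous_on_Pair[OF continuous_on_const[of W 1] continuous_on_id]
        by (auto simp: image_subset_iff)
      then have "(\<lambda>n. S 1 (\<sigma> (real n) u)) \<longlonglongrightarrow> S 1 z"
        using lim z by (rule continuous_on_tendsto_compose) (simp add: \<sigma>(3) u)
      moreover have "S 1 (\<sigma> (real n) u) = \<sigma> (real (Suc n)) u" for n
        using \<sigma>(4)[of 1 n u] by (simp add: add.commute)
      moreover have "(\<lambda>n. \<sigma> (real (Suc n)) u) \<longlonglongrightarrow> z" using lim by (rule LIMSEQ_Suc)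
      ultimately have "S 1 z = z" using LIMSEQ_unique by simp
      then show False using S(4)[OF z] by simp
    qed
  qed (use lip cer assms(5) nocrit W_def \<sigma>(1-3) in blast)+
  \<comment> \<open>Above \<open>a\<close> and below \<open>b\<close> there are no critical points,
    and those of level \<open>b\<close> have been removed. Conversely, a point of level at most
    \<open>a\<close> cannot have level \<open>b\<close>, as \<open>a < b\<close>.\<close>
  have dom: "sublevel \<phi> b - crit_at \<phi> b = W \<union> {u. \<phi> u \<le> a}"
  proof (intro set_eqI iffI)
    fix u assume u: "u \<in> sublevel \<phi> b - crit_at \<phi> b"
    show "u \<in> W \<union> {u. \<phi> u \<le> a}"
    proof (cases "\<phi> u \<le> a")
      case False
      moreover have "u \<notin> crit \<phi>"
        using u nocrit[of "\<phi> u"] False by (auto simp: sublevel_def crit_at_def order_le_less)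
      ultimately show ?thesis using u by (auto simp: W_def sublevel_def)
    qed simp
  next
    fix u assume "u \<in> W \<union> {u. \<phi> u \<le> a}"
    moreover have "ereal (\<phi> u) < b" if "\<phi> u \<le> a"
      using assms(4) that by (metis ereal_less_eq(3) order_le_less_trans)
    ultimately show "u \<in> sublevel \<phi> b - crit_at \<phi> b"
      by (auto simp: W_def sublevel_def crit_at_def less_imp_le)
  qed
  show ?thesis unfolding dom
  proof (intro exI[of _ homotopy] conjI ballI)
    show "continuous_on ({0..1} \<times> (W \<union> {u. \<phi> u \<le> a})) (\<lambda>(t, u). homotopy t u)"
      by (rule continuous_on_homotopy)
  next
    fix t :: real and u assume t: "t \<in> {0..1}" and u: "u \<in> W \<union> {u. \<phi> u \<le> a}"
    show "homotopy t u \<in> W \<union> {u. \<phi> u \<le> a}" "\<phi> (homotopy t u) \<le> \<phi> u"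
      using homotopy_cases[OF _ t, of u] u by (cases "\<phi> u \<le> a"; auto simp: homotopy_def)+
  next
    fix u assume u: "u \<in> W \<union> {u. \<phi> u \<le> a}"
    show "homotopy 0 u = u" by (simp add: homotopy_def start)
    show "homotopy 1 u \<in> sublevel \<phi> (ereal a)"
      using u endpoint(1)[of u] by (auto simp: homotopy_def sublevel_def)
  next
    fix t :: real and u assume "u \<in> sublevel \<phi> (ereal a)"
    then show "homotopy t u = u" by (simp add: homotopy_def sublevel_def)
  qed
qed

end
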